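(* Let $U$ be a nonzero real $n\times m$ matrix and let $\widetilde{U}$ be the matrix whose columns are the columns of $U$ normalized. For all $\varepsilon\in(0,1)$ there exists $\sigma\subset\{1,\dots,m\}$, consisting of indices $j$ with $Ue_j\neq 0$, of size $$|\sigma|\geq (1-\varepsilon)^2\,\frac{\|U\|_{\rm HS}^2}{\|U\|^2}$$ such that $$\frac{\varepsilon}{2-\varepsilon}\leq s_{\min}\left(\widetilde{U}_\sigma\right)\leq s_{\max}\left(\widetilde{U}_\sigma\right)\leq \frac{2-\varepsilon}{\varepsilon}.$$ In other terms, for all real $(a_j)_{j\in\sigma}$, $$\frac{\varepsilon}{2-\varepsilon}\Big(\sum_{j\in\sigma}a_j^2\Big)^{1/2}\leq\Big\|\sum_{j\in\sigma}a_j\frac{Ue_j}{\|Ue_j\|_2}\Big\|_2\leq\frac{2-\varepsilon}{\varepsilon}\Big(\sum_{j\in\sigma}a_j^2\Big)^{1/2}.$$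
   Context: $(e_j)_{j\le m}$ is the canonical basis of $\mathbb{R}^m$, so $Ue_j$ is the $j$-th column of $U$. $\|U\|_{\rm HS}^2={\rm Tr}(UU^t)$ is the squared Hilbert-Schmidt norm and $\|U\|$ is the operator norm of $U:\ell_2^m\to\ell_2^n$. The $j$-th column of $\widetilde U$ is $Ue_j/\|Ue_j\|_2$ when $Ue_j\ne0$ (zero columns are left equal to $0$). For $\sigma\subset\{1,\dots,m\}$, $\widetilde U_\sigma$ is the restriction of $\widetilde U$ to the columns with indices in $\sigma$, viewed as an operator $\mathbb{R}^\sigma\to\mathbb{R}^n$; $s_{\min}(\widetilde U_\sigma)$ and $s_{\max}(\widetilde U_\sigma)$ are the minimum and maximum of $\|\widetilde U_\sigma x\|_2$ over unit vectors $x\in\mathbb{R}^\sigma$. *)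

theory Defs
  imports "HOL-Analysis.Analysis"
begin

text \<open>An \<open>n \<times> m\<close> matrix is a \<open>U :: real^'m^'n\<close>; \<open>column j U\<close> is \<open>U e\<^sub>j\<close>
  (library lemma \<open>matrix_vector_mult_basis\<close>).\<close>

definition hs_norm :: "real^'m^'n \<Rightarrow> real" where
  "hs_norm U = sqrt (trace (U ** transpose U))"

text \<open>The norm is Euclidean on both sides, i.e. from \<open>\<ell>\<^sub>2\<^sup>m\<close> to \<open>\<ell>\<^sub>2\<^sup>n\<close>.\<close>

definition op_norm :: "real^'m^'n \<Rightarrow> real" where
  "op_norm U = onorm (\<lambda>x. U *v x)"

text \<open>A zero column stays zero, because division by zero yields zero.\<close>

definition normalize_columns :: "real^'m^'n \<Rightarrow> real^'m^'n" where
  "normalize_columns U = (\<chi> i j. U $ i $ j / norm (column j U))"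

text \<open>The space \<open>\<real>\<^sup>\<sigma>\<close> is identified isometrically with the vectors of \<open>\<real>\<^sup>m\<close> that vanish
  outside \<open>\<sigma>\<close>. On such vectors \<open>A\<close> acts as its restriction \<open>A\<^sub>\<sigma>\<close> to the columns in \<open>\<sigma>\<close>.\<close>

definition unit_vectors_on :: "'m set \<Rightarrow> (real^'m) set" where
  "unit_vectors_on \<sigma> = {x. norm x = 1 \<and> (\<forall>j. j \<notin> \<sigma> \<longrightarrow> x $ j = 0)}"

text \<open>For nonempty \<open>\<sigma>\<close> the infimum and supremum below are attained; see \<open>s_min_attained\<close>
  and \<open>s_max_attained\<close>.\<close>

definition s_min :: "real^'m^'n \<Rightarrow> 'm set \<Rightarrow> real" where
  "s_min A \<sigma> = (INF x\<in>unit_vectors_on \<sigma>. norm (A *v x))"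

definition s_max :: "real^'m^'n \<Rightarrow> 'm set \<Rightarrow> real" where
  "s_max A \<sigma> = (SUP x\<in>unit_vectors_on \<sigma>. norm (A *v x))"

lemma column_normalize_columns:
  "column j (normalize_columns U) = column j U /\<^sub>R norm (column j U)"
  by (simp add: normalize_columns_def column_def vec_eq_iff divide_inverse mult.commute)

lemma hs_norm_power2: "(hs_norm U)\<^sup>2 = trace (U ** transpose U)"
proof -
  have "0 \<le> trace (U ** transpose U)"
    by (auto simp: trace_def matrix_matrix_mult_def transpose_def intro!: sum_nonneg)
  then show ?thesis
    by (simp add: hs_norm_def)
qed

lemma unit_vectors_on_nonempty:
  assumes "\<sigma> \<noteq> {}"
  shows "unit_vectors_on \<sigma> \<noteq> {}"
proof -
  obtain j where "j \<in> \<sigma>" using assms by blast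
  then have "axis j 1 \<in> unit_vectors_on \<sigma>"
    by (auto simp: unit_vectors_on_def axis_def norm_axis_1[unfolded axis_def])
  then show ?thesis by blast
qed

lemma compact_unit_vectors_on: "compact (unit_vectors_on (\<sigma> :: ('m::finite) set))"
proof -
  have "unit_vectors_on \<sigma> = sphere 0 1 \<inter> (\<Inter>j\<in>-\<sigma>. {x. x $ j = 0})"
    by (auto simp: unit_vectors_on_def)
  moreover have "closed (\<Inter>j\<in>-\<sigma>. {x::real^'m. x $ j = 0})"
    by (intro closed_INT ballI closed_Collect_eq continuous_intros)
  ultimately show ?thesis
    by (simp add: compact_Int_closed)
qed

lemma continuous_on_norm_mult_vec: "continuous_on S (\<lambda>x. norm ((A::real^'m^'n) *v x))"
  by (intro continuous_on_norm linear_continuous_on matrix_vector_mul_bounded_linear)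

lemma s_min_attained:
  assumes "\<sigma> \<noteq> {}"
  shows "\<exists>x\<in>unit_vectors_on \<sigma>. s_min A \<sigma> = norm (A *v x) \<and>
           (\<forall>y\<in>unit_vectors_on \<sigma>. norm (A *v x) \<le> norm (A *v y))"
proof -
  obtain x where x: "x \<in> unit_vectors_on \<sigma>"
      "\<forall>y\<in>unit_vectors_on \<sigma>. norm (A *v x) \<le> norm (A *v y)"
    using continuous_attains_inf[OF compact_unit_vectors_on unit_vectors_on_nonempty[OF assms]
        continuous_on_norm_mult_vec] by blast
  then have "s_min A \<sigma> = norm (A *v x)"
    unfolding s_min_def by (intro cInf_eq_minimum) auto
  with x show ?thesis by blast
qed

lemma s_max_attained:
  assumes "\<sigma> \<noteq> {}"
  shows "\<exists>x\<in>unit_vectors_on \<sigma>. s_max A \<sigma> = norm (A *v x) \<and>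
           (\<forall>y\<in>unit_vectors_on \<sigma>. norm (A *v y) \<le> norm (A *v x))"
proof -
  obtain x where x: "x \<in> unit_vectors_on \<sigma>"
      "\<forall>y\<in>unit_vectors_on \<sigma>. norm (A *v y) \<le> norm (A *v x)"
    using continuous_attains_sup[OF compact_unit_vectors_on unit_vectors_on_nonempty[OF assms]
        continuous_on_norm_mult_vec] by blast
  then have "s_max A \<sigma> = norm (A *v x)"
    unfolding s_max_def by (intro cSup_eq_maximum) auto
  with x show ?thesis by blast
qed

end

theory Submission
  imports Defs
begin

text \<open>
  Scaling \<open>U\<close> to operator norm \<open>1\<close> leaves the normalized columns unchanged and turns the columns into
  vectors \<open>v\<^sub>j\<close> satisfying the Bessel inequality \<open>\<Sum>\<^sub>j \<langle>v\<^sub>j, x\<rangle>\<^sup>2 \<le> \<parallel>x\<parallel>\<^sup>2\<close>, with total mass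
  \<open>H = \<Sum>\<^sub>j \<parallel>v\<^sub>j\<parallel>\<^sup>2\<close> equal to the quotient of the squared norms. The set \<open>\<sigma>\<close> is built one vector at a
  time, by the barrier argument of Batson, Spielman and Srivastava. Along with \<open>\<sigma>\<close> come weights
  \<open>c\<^sub>j > 0\<close> such that \<open>A = \<Sum>\<^sub>j\<^sub>\<in>\<^sub>\<sigma> c\<^sub>j v\<^sub>j v\<^sub>j\<^sup>t\<close> is at most \<open>u\<close> everywhere and at least \<open>b\<close> on the span of
  the chosen vectors; each new vector moves \<open>b\<close> down and \<open>u\<close> up by fixed amounts.

  The distance of the spectrum of \<open>A\<close> to a barrier \<open>t\<close> is measured by the potential
  \<open>\<Sum>\<^sub>j \<langle>v\<^sub>j, (t - A)\<^sup>-\<^sup>1 v\<^sub>j\<rangle>\<close>. At \<open>t = u\<close> it must stay small. At \<open>t = b\<close> it must stay large: there the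
  kernel of \<open>A\<close> contributes positively and the span of the chosen vectors negatively. By the
  Sherman-Morrison formula, adding \<open>\<gamma> w w\<^sup>t\<close> changes the potential by \<open>\<ell>(w) / (1/\<gamma> - q(w))\<close>, where
  \<open>q(w) = \<langle>w, (t - A)\<^sup>-\<^sup>1 w\<rangle>\<close> and \<open>\<ell>(w) = \<Sum>\<^sub>i \<langle>v\<^sub>i, (t - A)\<^sup>-\<^sup>1 w\<rangle>\<^sup>2\<close>. Moving the two barriers gains
  \<open>\<Delta>\<^sub>b, \<Delta>\<^sub>u > 0\<close>, and spending these gains on the new vector \<open>w\<close> keeps both potentials in range as soon as
  \<open>q\<^sub>u(w) + \<ell>\<^sub>u(w) / \<Delta>\<^sub>u < 1/\<gamma> < q\<^sub>b(w) - \<ell>\<^sub>b(w) / \<Delta>\<^sub>b\<close>. A suitable \<open>\<gamma>\<close> exists for some \<open>w = v\<^sub>j\<close> if the sum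
  of the left side over all \<open>j\<close> is smaller than the sum of the right side. The Bessel inequality
  bounds \<open>\<Sum>\<^sub>j \<ell>(v\<^sub>j)\<close> by \<open>\<Delta>\<^sub>u / \<delta>\<^sub>u\<close> (lemma \<open>upper_barrier_shift\<close>) and by \<open>\<Delta>\<^sub>b / \<delta>\<^sub>b + \<Delta>\<^sub>b\<^sup>2\<close> (lemma
  \<open>lower_barrier_shift\<close>), so the condition becomes
  \<open>\<Psi> + 1/\<delta>\<^sub>u \<le> \<Phi> - 1/\<delta>\<^sub>b\<close> for the bounds \<open>\<Psi>\<close>, \<open>\<Phi>\<close> on the potentials (lemma \<open>barrier_step\<close>).

  For \<open>A = 0\<close> the potential at \<open>t\<close> is \<open>H / t\<close>. With initial barriers \<open>\<epsilon>\<close> and \<open>2 - \<epsilon>\<close> and shifts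
  \<open>\<epsilon> / ((1 - \<epsilon>) H)\<close> and \<open>(2 - \<epsilon>) / ((1 - \<epsilon>) H)\<close> both sides of the condition are equal to \<open>H\<close>. After
  fewer than \<open>(1 - \<epsilon>)\<^sup>2 H\<close> steps the barriers have not passed \<open>\<epsilon>\<^sup>2\<close> and \<open>(2 - \<epsilon>)\<^sup>2\<close>. One further vector
  can be added without moving the barriers (lemma \<open>barrier_last_step\<close>), since nothing has to be
  preserved for later; this takes the size of \<open>\<sigma>\<close> up to the next integer.

  Finally, each rescaled weight \<open>c\<^sub>j \<parallel>v\<^sub>j\<parallel>\<^sup>2\<close> lies itself between \<open>b\<close> and \<open>u\<close>, so dropping the weights
  costs a factor \<open>u\<close> in the lower and \<open>1/b\<close> in the upper bound: the normalized Gram matrix has its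
  spectrum in \<open>[b/u, u/b]\<close> (lemma \<open>unweight\<close>). Square roots of the end points are the constants of the
  theorem.
\<close>

section \<open>Resolvents of self-adjoint operators\<close>

text \<open>A right inverse of \<open>t - A\<close>; in finite dimension it is the inverse. As a predicate it
  allows the resolvent of an updated operator to be written down explicitly.\<close>

definition is_resolvent :: "('a::euclidean_space \<Rightarrow> 'a) \<Rightarrow> real \<Rightarrow> ('a \<Rightarrow> 'a) \<Rightarrow> bool" where
  "is_resolvent A t R \<longleftrightarrow> linear R \<and> (\<forall>x. t *\<^sub>R R x - A (R x) = x)"

definition potential :: "'j set \<Rightarrow> ('j \<Rightarrow> 'a::euclidean_space) \<Rightarrow> ('a \<Rightarrow> 'a) \<Rightarrow> real" where
  "potential J v R = (\<Sum>j\<in>J. v j \<bullet> R (v j))"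

text \<open>The coefficient with which a rank-one update in direction \<open>w\<close> enters the potential; see
  \<open>potential_rank_one\<close>.\<close>

definition leverage :: "'j set \<Rightarrow> ('j \<Rightarrow> 'a::euclidean_space) \<Rightarrow> ('a \<Rightarrow> 'a) \<Rightarrow> 'a \<Rightarrow> real" where
  "leverage J v R w = (\<Sum>i\<in>J. (v i \<bullet> R w)\<^sup>2)"

lemma is_resolventD:
  assumes "is_resolvent A t R"
  shows "linear R" "t *\<^sub>R R x - A (R x) = x"
  using assms by (auto simp: is_resolvent_def)

lemma resolvent_exists:
  fixes A :: "'a::euclidean_space \<Rightarrow> 'a"
  assumes "linear A" and ker: "\<And>x. t *\<^sub>R x - A x = 0 \<Longrightarrow> x = 0"
  obtains R where "is_resolvent A t R"
proof -
  let ?f = "\<lambda>x. t *\<^sub>R x - A x"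
  have lin: "linear ?f"
    using assms(1) by (intro linear_compose_sub linear_scale_self)
  then have "inj ?f"
    using ker by (subst linear_injective_0) auto
  with lin obtain R where "linear R" "\<forall>x. ?f (R x) = x"
    using linear_injective_isomorphism by blast
  with that show ?thesis by (auto simp: is_resolvent_def)
qed

lemma resolvent_selfadjoint:
  assumes sa: "\<And>x y. A x \<bullet> y = x \<bullet> A y" and R: "is_resolvent A t R"
  shows "R x \<bullet> y = x \<bullet> R y"
proof -
  have "R x \<bullet> y = R x \<bullet> (t *\<^sub>R R y - A (R y))"
    using is_resolventD(2)[OF R] by simp
  also have "\<dots> = (t *\<^sub>R R x - A (R x)) \<bullet> R y"
    by (simp add: inner_diff_left inner_diff_right sa)
  finally show ?thesis
    using is_resolventD(2)[OF R] by simp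
qed

text \<open>This bounds from below what moving a barrier by \<open>\<delta>\<close> gains. In resolvent form, with
  \<open>z = M\<^sup>-\<^sup>1 w\<close> and \<open>z' = (M + \<delta>)\<^sup>-\<^sup>1 w\<close>, the gain is exactly \<open>\<delta> \<langle>z', z\<rangle>\<close>, and
  \<open>M (z - z') = \<delta> z'\<close> shows that \<open>\<langle>z', z - z'\<rangle>\<close> has the sign of the form \<open>M\<close> at \<open>z - z'\<close>. Only this one
  value of the form matters, so the lemma serves both \<open>M = u - A\<close> and \<open>M = A - b\<close>, of which the
  latter is nonnegative only on a subspace.\<close>

lemma resolvent_shift_gain:
  fixes M :: "'a::real_inner \<Rightarrow> 'a"
  assumes "linear M" and sa: "\<And>x y. M x \<bullet> y = x \<bullet> M y"
    and z: "M z = w" and z': "M z' + \<delta> *\<^sub>R z' = w"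
    and nonneg: "0 \<le> M (z - z') \<bullet> (z - z')"
  shows "\<delta> * (z' \<bullet> z') \<le> w \<bullet> z - w \<bullet> z'"
proof -
  have "M (z - z') = \<delta> *\<^sub>R z'"
    using z z' by (simp add: linear_diff[OF assms(1)] algebra_simps)
  then have "0 \<le> \<delta> * (z' \<bullet> z) - \<delta> * (z' \<bullet> z')"
    using nonneg by (simp add: inner_diff_right)
  moreover have "w \<bullet> z = M z' \<bullet> z + \<delta> * (z' \<bullet> z)"
    by (simp add: z'[symmetric] inner_add_left)
  moreover have "M z' \<bullet> z = w \<bullet> z'"
    using sa[of z' z] by (simp add: z inner_commute)
  ultimately show ?thesis by linarith
qed

text \<open>The new resolvent is the old one plus a multiple of \<open>R w w\<^sup>t R\<close>; the coefficient is
  the solution \<open>k\<close> of \<open>k = \<gamma> + \<gamma> k \<langle>w, R w\<rangle>\<close>.\<close>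

lemma sherman_morrison:
  assumes lin: "linear A" and R: "is_resolvent A t R"
    and nz: "1 - \<gamma> * (w \<bullet> R w) \<noteq> 0"
  shows "is_resolvent (\<lambda>x. A x + (\<gamma> * (w \<bullet> x)) *\<^sub>R w) t
           (\<lambda>x. R x + (\<gamma> / (1 - \<gamma> * (w \<bullet> R w)) * (w \<bullet> R x)) *\<^sub>R R w)" (is "is_resolvent ?A t ?R")
proof -
  define k where "k = \<gamma> / (1 - \<gamma> * (w \<bullet> R w))"
  have k: "k - \<gamma> - \<gamma> * k * (w \<bullet> R w) = 0"
    using nz by (simp add: k_def field_simps)
  have linR: "linear R" using is_resolventD(1)[OF R] .
  have "linear ?R"
    unfolding k_def[symmetric]
    by (rule linearI) (simp_all add: linear_add[OF linR] linear_scale[OF linR] algebra_simps)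
  moreover have "t *\<^sub>R ?R x - ?A (?R x) = x" for x
  proof -
    let ?s = "w \<bullet> R x"
    have "t *\<^sub>R ?R x - ?A (?R x) = (t *\<^sub>R R x - A (R x)) + (k * ?s) *\<^sub>R (t *\<^sub>R R w - A (R w))
        - (\<gamma> * (?s + k * ?s * (w \<bullet> R w))) *\<^sub>R w"
      by (simp add: k_def[symmetric] linear_add[OF lin] linear_scale[OF lin] inner_add_right
          scaleR_diff_right scaleR_add_right algebra_simps)
    also have "\<dots> = x + (?s * (k - \<gamma> - \<gamma> * k * (w \<bullet> R w))) *\<^sub>R w"
      using is_resolventD(2)[OF R] by (simp add: algebra_simps)
    finally show ?thesis by (simp add: k)
  qed
  ultimately show ?thesis by (simp add: is_resolvent_def)
qed

lemma potential_rank_one: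
  assumes sa: "\<And>x y. R x \<bullet> y = x \<bullet> R y"
  shows "potential J v (\<lambda>x. R x + (k * (w \<bullet> R x)) *\<^sub>R R w) = potential J v R + k * leverage J v R w"
proof -
  have "w \<bullet> R x = x \<bullet> R w" for x using sa[of w x] by (simp add: inner_commute)
  then show ?thesis
    by (simp add: potential_def leverage_def inner_add_right sum.distrib sum_distrib_left
        power2_eq_square mult.assoc)
qed

section \<open>Weighted families between two barriers\<close>

definition frame_op :: "('j \<Rightarrow> 'a::euclidean_space) \<Rightarrow> ('j \<Rightarrow> real) \<Rightarrow> 'j set \<Rightarrow> 'a \<Rightarrow> 'a" where
  "frame_op v c \<sigma> x = (\<Sum>j\<in>\<sigma>. (c j * (v j \<bullet> x)) *\<^sub>R v j)"

text \<open>With \<open>W\<close> the operator whose columns are \<open>sqrt c\<^sub>j v\<^sub>j\<close>, the conditions are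
  \<open>b \<le> W\<^sup>t W\<close> and \<open>W W\<^sup>t \<le> u\<close>. The lower condition is put on the Gram side, in the coordinates
  \<open>x\<^sub>j = sqrt c\<^sub>j a\<^sub>j\<close>, because there it also encodes linear independence, and it is the form in which
  it survives the addition of a vector by completing a square. The upper condition is put on the operator
  side, where it is a bound for the quadratic form of \<open>frame_op\<close>.\<close>

definition between_barriers ::
  "('j \<Rightarrow> 'a::euclidean_space) \<Rightarrow> ('j \<Rightarrow> real) \<Rightarrow> 'j set \<Rightarrow> real \<Rightarrow> real \<Rightarrow> bool" where
  "between_barriers v c \<sigma> b u \<longleftrightarrow>
     (\<forall>j\<in>\<sigma>. 0 < c j) \<and>
     (\<forall>x. b * (\<Sum>j\<in>\<sigma>. (x j)\<^sup>2 / c j) \<le> (norm (\<Sum>j\<in>\<sigma>. x j *\<^sub>R v j))\<^sup>2) \<and>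
     (\<forall>y. (\<Sum>j\<in>\<sigma>. c j * (v j \<bullet> y)\<^sup>2) \<le> u * (norm y)\<^sup>2)"

lemma linear_frame_op: "linear (frame_op v c \<sigma>)"
  by (rule linearI) (simp_all add: frame_op_def inner_add_right algebra_simps sum.distrib
      scaleR_sum_right scaleR_add_left)

lemma frame_op_selfadjoint: "frame_op v c \<sigma> x \<bullet> y = x \<bullet> frame_op v c \<sigma> y"
  by (simp add: frame_op_def inner_sum_left inner_sum_right inner_commute mult_ac)

lemma frame_op_form: "x \<bullet> frame_op v c \<sigma> x = (\<Sum>j\<in>\<sigma>. c j * (v j \<bullet> x)\<^sup>2)"
  by (simp add: frame_op_def inner_sum_right power2_eq_square inner_commute mult_ac)

lemma frame_op_insert:
  assumes "finite \<sigma>" "j \<notin> \<sigma>"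
  shows "frame_op v (c(j := \<gamma>)) (insert j \<sigma>) = (\<lambda>x. frame_op v c \<sigma> x + (\<gamma> * (v j \<bullet> x)) *\<^sub>R v j)"
proof
  fix x
  have "(\<Sum>i\<in>\<sigma>. ((c(j := \<gamma>)) i * (v i \<bullet> x)) *\<^sub>R v i) = (\<Sum>i\<in>\<sigma>. (c i * (v i \<bullet> x)) *\<^sub>R v i)"
    using assms by (intro sum.cong) auto
  then show "frame_op v (c(j := \<gamma>)) (insert j \<sigma>) x = frame_op v c \<sigma> x + (\<gamma> * (v j \<bullet> x)) *\<^sub>R v j"
    using assms by (simp add: frame_op_def)
qed

lemma frame_op_in_span: "frame_op v c \<sigma> x \<in> span (v ` \<sigma>)"
  unfolding frame_op_def by (intro span_sum span_scale span_base) auto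

lemma frame_op_orthogonal:
  assumes "\<And>e. e \<in> span (v ` \<sigma>) \<Longrightarrow> orthogonal p e"
  shows "frame_op v c \<sigma> p = 0"
proof -
  have "v j \<bullet> p = 0" if "j \<in> \<sigma>" for j
    using assms[OF span_base, of "v j"] that by (simp add: orthogonal_def inner_commute)
  then show ?thesis by (simp add: frame_op_def)
qed

lemma span_image_sum:
  assumes "finite \<sigma>" "y \<in> span (v ` \<sigma>)"
  obtains x where "y = (\<Sum>j\<in>\<sigma>. x j *\<^sub>R v j)"
proof -
  let ?E = "range (\<lambda>x. \<Sum>j\<in>\<sigma>. x j *\<^sub>R v j)"
  have "subspace ?E"
    unfolding subspace_def
  proof (intro conjI ballI allI)
    show "0 \<in> ?E" by (intro image_eqI[where x = "\<lambda>_. 0"]) auto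
  next
    fix a b assume "a \<in> ?E" "b \<in> ?E"
    then obtain x y where "a = (\<Sum>j\<in>\<sigma>. x j *\<^sub>R v j)" "b = (\<Sum>j\<in>\<sigma>. y j *\<^sub>R v j)" by auto
    then show "a + b \<in> ?E"
      by (intro image_eqI[where x = "\<lambda>j. x j + y j"]) (auto simp: algebra_simps sum.distrib)
  next
    fix k a assume "a \<in> ?E"
    then obtain x where "a = (\<Sum>j\<in>\<sigma>. x j *\<^sub>R v j)" by auto
    then show "k *\<^sub>R a \<in> ?E"
      by (intro image_eqI[where x = "\<lambda>j. k * x j"]) (auto simp: scaleR_sum_right)
  qed
  moreover have "v ` \<sigma> \<subseteq> ?E"
  proof safe
    fix i assume "i \<in> \<sigma>"
    then have "(\<Sum>j\<in>\<sigma>. (if j = i then 1 else 0) *\<^sub>R v j) = v i"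
      using assms(1) by (simp add: if_distrib[where f = "\<lambda>r. r *\<^sub>R _"] sum.delta cong: if_cong)
    then show "v i \<in> ?E"
      by (intro image_eqI[where x = "\<lambda>j. if j = i then 1 else 0"]) auto
  qed
  ultimately have "span (v ` \<sigma>) \<subseteq> ?E" by (intro span_minimal)
  then have "y \<in> ?E" using assms(2) by (rule subsetD)
  then show ?thesis using that by (elim imageE)
qed

text \<open>This is the passage from \<open>b \<le> W\<^sup>t W\<close> to \<open>b \<le> W W\<^sup>t\<close> on the range of \<open>W\<close>: for \<open>y = W a\<close>
  the Cauchy-Schwarz inequality gives \<open>\<parallel>y\<parallel>\<^sup>4 = \<langle>a, W\<^sup>t y\<rangle>\<^sup>2 \<le> \<parallel>a\<parallel>\<^sup>2 \<parallel>W\<^sup>t y\<parallel>\<^sup>2\<close>, and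
  \<open>b \<parallel>a\<parallel>\<^sup>2 \<le> \<parallel>y\<parallel>\<^sup>2\<close>.\<close>

lemma frame_op_lower_on_span:
  assumes bar: "between_barriers v c \<sigma> b u" and "finite \<sigma>" and b: "0 < b"
    and y: "y \<in> span (v ` \<sigma>)"
  shows "b * (y \<bullet> y) \<le> y \<bullet> frame_op v c \<sigma> y"
proof -
  obtain x where x: "y = (\<Sum>j\<in>\<sigma>. x j *\<^sub>R v j)"
    using span_image_sum[OF assms(2) y] .
  have c: "\<And>j. j \<in> \<sigma> \<Longrightarrow> 0 < c j" using bar by (auto simp: between_barriers_def)
  define S where "S = (\<Sum>j\<in>\<sigma>. (x j)\<^sup>2 / c j)"
  define T where "T = (\<Sum>j\<in>\<sigma>. c j * (v j \<bullet> y)\<^sup>2)"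
  have "T \<ge> 0" unfolding T_def using c by (intro sum_nonneg) (auto simp: less_imp_le)
  have bS: "b * S \<le> y \<bullet> y"
    using bar unfolding between_barriers_def S_def x by (auto simp: power2_norm_eq_inner)
  have "y \<bullet> y = (\<Sum>j\<in>\<sigma>. x j * (v j \<bullet> y))"
    by (subst x) (simp add: inner_sum_left)
  also have "\<dots> = (\<Sum>j\<in>\<sigma>. (x j / sqrt (c j)) * (sqrt (c j) * (v j \<bullet> y)))"
    by (intro sum.cong refl) (use c in \<open>force\<close>)
  finally have "(y \<bullet> y)\<^sup>2 \<le> (\<Sum>j\<in>\<sigma>. (x j / sqrt (c j))\<^sup>2) * (\<Sum>j\<in>\<sigma>. (sqrt (c j) * (v j \<bullet> y))\<^sup>2)"
    using Cauchy_Schwarz_ineq_sum[of "\<lambda>j. x j / sqrt (c j)" "\<lambda>j. sqrt (c j) * (v j \<bullet> y)" \<sigma>] by simp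
  also have "\<dots> = S * T"
    unfolding S_def T_def
    by (intro arg_cong2[where f = "(*)"] sum.cong refl)
      (auto simp: power_divide power_mult_distrib less_imp_le c)
  finally have "b * (y \<bullet> y)\<^sup>2 \<le> b * (S * T)" using b by simp
  also have "\<dots> \<le> (y \<bullet> y) * T" using bS \<open>T \<ge> 0\<close> mult_right_mono[of "b * S" "y \<bullet> y" T] by (simp add: mult.assoc)
  finally have *: "(y \<bullet> y) * (b * (y \<bullet> y)) \<le> (y \<bullet> y) * T" by (simp add: power2_eq_square mult_ac)
  show ?thesis
  proof (cases "y = 0")
    case False
    then have "0 < y \<bullet> y" by simp
    then show ?thesis using * by (simp add: frame_op_form T_def)
  qed (simp add: frame_op_form)
qed

lemma between_barriers_mono:
  fixes v :: "'j \<Rightarrow> 'a::euclidean_space"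
  assumes bar: "between_barriers v c \<sigma> b u" and "b' \<le> b" "u \<le> u'"
  shows "between_barriers v c \<sigma> b' u'"
  unfolding between_barriers_def
proof (intro conjI allI)
  show c: "\<forall>j\<in>\<sigma>. 0 < c j" using bar by (simp add: between_barriers_def)
  fix x :: "'j \<Rightarrow> real"
  have "0 \<le> (\<Sum>j\<in>\<sigma>. (x j)\<^sup>2 / c j)"
    using c by (intro sum_nonneg divide_nonneg_nonneg) (auto intro: less_imp_le)
  with \<open>b' \<le> b\<close> have "b' * (\<Sum>j\<in>\<sigma>. (x j)\<^sup>2 / c j) \<le> b * (\<Sum>j\<in>\<sigma>. (x j)\<^sup>2 / c j)"
    by (rule mult_right_mono)
  also have "\<dots> \<le> (norm (\<Sum>j\<in>\<sigma>. x j *\<^sub>R v j))\<^sup>2"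
    using bar by (simp add: between_barriers_def)
  finally show "b' * (\<Sum>j\<in>\<sigma>. (x j)\<^sup>2 / c j) \<le> (norm (\<Sum>j\<in>\<sigma>. x j *\<^sub>R v j))\<^sup>2" .
next
  fix y :: 'a
  have "(\<Sum>j\<in>\<sigma>. c j * (v j \<bullet> y)\<^sup>2) \<le> u * (norm y)\<^sup>2"
    using bar by (simp add: between_barriers_def)
  also have "\<dots> \<le> u' * (norm y)\<^sup>2"
    using \<open>u \<le> u'\<close> by (intro mult_right_mono) auto
  finally show "(\<Sum>j\<in>\<sigma>. c j * (v j \<bullet> y)\<^sup>2) \<le> u' * (norm y)\<^sup>2" .
qed

text \<open>Both halves complete a square with \<open>z = (t - A)\<^sup>-\<^sup>1 v\<^sub>j\<close>. With coefficient \<open>1\<close> at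
  \<open>v\<^sub>j\<close>, the least value of \<open>\<parallel>v\<^sub>j + \<Sum>\<^sub>i x\<^sub>i v\<^sub>i\<parallel>\<^sup>2 - b \<Sum>\<^sub>i x\<^sub>i\<^sup>2 / c\<^sub>i\<close> over the old coefficients is
  \<open>b \<langle>v\<^sub>j, (b - A)\<^sup>-\<^sup>1 v\<^sub>j\<rangle>\<close>, which must pay for the new term \<open>b / \<gamma>\<close>. The upper bound is the Cauchy-Schwarz
  inequality for the form \<open>u - A\<close>.\<close>

lemma between_barriers_insert:
  assumes bar: "between_barriers v c \<sigma> b u" and fin: "finite \<sigma>" and j: "j \<notin> \<sigma>" and b: "0 < b"
    and Rb: "is_resolvent (frame_op v c \<sigma>) b Rb" and Ru: "is_resolvent (frame_op v c \<sigma>) u Ru"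
    and \<gamma>: "0 < \<gamma>" and lo: "1 / \<gamma> \<le> v j \<bullet> Rb (v j)" and up: "v j \<bullet> Ru (v j) \<le> 1 / \<gamma>"
  shows "between_barriers v (c(j := \<gamma>)) (insert j \<sigma>) b u"
  unfolding between_barriers_def
proof (intro conjI allI)
  let ?c = "c(j := \<gamma>)"
  let ?A = "frame_op v c \<sigma>"
  have c: "\<And>i. i \<in> \<sigma> \<Longrightarrow> 0 < c i" using bar by (auto simp: between_barriers_def)
  show "\<forall>i\<in>insert j \<sigma>. 0 < ?c i" using c \<gamma> by auto
  show "b * (\<Sum>i\<in>insert j \<sigma>. (x i)\<^sup>2 / ?c i) \<le> (norm (\<Sum>i\<in>insert j \<sigma>. x i *\<^sub>R v i))\<^sup>2" for x
  proof -
    \<comment> \<open>The minimizing coefficients are \<open>c i * (v i \<bullet> z)\<close>; \<open>h\<close> is the deviation from them.\<close>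
    define z where "z = x j *\<^sub>R Rb (v j)"
    have z: "b *\<^sub>R z - ?A z = x j *\<^sub>R v j"
      using arg_cong[OF is_resolventD(2)[OF Rb, of "v j"], of "\<lambda>y. x j *\<^sub>R y"]
      by (simp add: z_def linear_scale[OF linear_frame_op] scaleR_diff_right mult.commute)
    define h where "h i = x i - c i * (v i \<bullet> z)" for i
    define w where "w = (\<Sum>i\<in>\<sigma>. h i *\<^sub>R v i)"
    have "(\<Sum>i\<in>\<sigma>. x i *\<^sub>R v i) = ?A z + w"
      by (simp add: frame_op_def w_def h_def algebra_simps sum_subtractf)
    moreover have "(\<Sum>i\<in>insert j \<sigma>. x i *\<^sub>R v i) = x j *\<^sub>R v j + (\<Sum>i\<in>\<sigma>. x i *\<^sub>R v i)"
      using fin j by simp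
    ultimately have y: "(\<Sum>i\<in>insert j \<sigma>. x i *\<^sub>R v i) = b *\<^sub>R z + w"
      using z by (simp add: algebra_simps)
    have "(\<Sum>i\<in>\<sigma>. (x i)\<^sup>2 / c i) = (\<Sum>i\<in>\<sigma>. c i * (v i \<bullet> z)\<^sup>2 + 2 * (h i * (v i \<bullet> z)) + (h i)\<^sup>2 / c i)"
    proof (intro sum.cong refl)
      fix i assume "i \<in> \<sigma>"
      then have "c i \<noteq> 0" using c by force
      then show "(x i)\<^sup>2 / c i = c i * (v i \<bullet> z)\<^sup>2 + 2 * (h i * (v i \<bullet> z)) + (h i)\<^sup>2 / c i"
        by (simp add: h_def field_simps power2_eq_square)
    qed
    also have "\<dots> = z \<bullet> ?A z + 2 * (w \<bullet> z) + (\<Sum>i\<in>\<sigma>. (h i)\<^sup>2 / c i)"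
      by (simp add: sum.distrib frame_op_form w_def inner_sum_left sum_distrib_left)
    finally have S: "(\<Sum>i\<in>\<sigma>. (x i)\<^sup>2 / c i) = z \<bullet> ?A z + 2 * (w \<bullet> z) + (\<Sum>i\<in>\<sigma>. (h i)\<^sup>2 / c i)" .
    have hw: "b * (\<Sum>i\<in>\<sigma>. (h i)\<^sup>2 / c i) \<le> w \<bullet> w"
      using bar unfolding between_barriers_def w_def by (auto simp: power2_norm_eq_inner)
    have "(x j)\<^sup>2 / \<gamma> \<le> (x j)\<^sup>2 * (v j \<bullet> Rb (v j))"
      using mult_left_mono[OF lo, of "(x j)\<^sup>2"] by simp
    also have "\<dots> = z \<bullet> (x j *\<^sub>R v j)"
      by (simp add: z_def power2_eq_square inner_commute)
    also have "\<dots> = b * (z \<bullet> z) - z \<bullet> ?A z"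
      by (simp add: z[symmetric] inner_diff_right)
    finally have "b * ((x j)\<^sup>2 / \<gamma>) \<le> b * (b * (z \<bullet> z) - z \<bullet> ?A z)"
      using b by (intro mult_left_mono) auto
    moreover have "(\<Sum>i\<in>\<sigma>. (x i)\<^sup>2 / ?c i) = (\<Sum>i\<in>\<sigma>. (x i)\<^sup>2 / c i)"
      using j by (intro sum.cong) auto
    ultimately show ?thesis
      using hw fin j unfolding y power2_norm_eq_inner
      by (simp add: S inner_add_left inner_add_right inner_commute algebra_simps)
  qed
  show "(\<Sum>i\<in>insert j \<sigma>. ?c i * (v i \<bullet> y)\<^sup>2) \<le> u * (norm y)\<^sup>2" for y
  proof -
    \<comment> \<open>The form \<open>u - A\<close> is nonnegative at \<open>y - s z\<close>. Taking \<open>\<gamma>\<close> in place of the optimal factor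
       \<open>1 / (v j \<bullet> z)\<close> avoids a division.\<close>
    define s where "s = \<gamma> * (v j \<bullet> y)"
    define z where "z = Ru (v j)"
    define x where "x = y - s *\<^sub>R z"
    have z: "u *\<^sub>R z - ?A z = v j" using is_resolventD(2)[OF Ru] by (simp add: z_def)
    have "0 \<le> u * (x \<bullet> x) - x \<bullet> ?A x"
      using bar by (auto simp: between_barriers_def frame_op_form power2_norm_eq_inner)
    also have "\<dots> = x \<bullet> (u *\<^sub>R x - ?A x)" by (simp add: inner_diff_right)
    also have "u *\<^sub>R x - ?A x = (u *\<^sub>R y - ?A y) - s *\<^sub>R (u *\<^sub>R z - ?A z)"
      by (simp add: x_def linear_diff[OF linear_frame_op] linear_scale[OF linear_frame_op] algebra_simps)
    also have "x \<bullet> \<dots> = (y \<bullet> (u *\<^sub>R y - ?A y)) - s * (z \<bullet> (u *\<^sub>R y - ?A y)) - s * (y \<bullet> v j) + s\<^sup>2 * (z \<bullet> v j)"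
      by (simp add: z x_def inner_diff_left inner_diff_right power2_eq_square algebra_simps)
    also have "z \<bullet> (u *\<^sub>R y - ?A y) = v j \<bullet> y"
      by (simp add: z[symmetric] inner_diff_left inner_diff_right frame_op_selfadjoint)
    finally have "0 \<le> y \<bullet> (u *\<^sub>R y - ?A y) - 2 * s * (v j \<bullet> y) + s\<^sup>2 * (v j \<bullet> z)"
      by (simp add: inner_commute)
    moreover have "s\<^sup>2 * (v j \<bullet> z) \<le> s * (v j \<bullet> y)"
    proof -
      have "s\<^sup>2 * (v j \<bullet> z) \<le> s\<^sup>2 * (1 / \<gamma>)"
        using up by (intro mult_left_mono) (auto simp: z_def)
      also have "\<dots> = s * (v j \<bullet> y)"
        using \<gamma> by (simp add: s_def power2_eq_square)
      finally show ?thesis .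
    qed
    ultimately have "s * (v j \<bullet> y) \<le> u * (y \<bullet> y) - y \<bullet> ?A y"
      by (simp add: inner_diff_right)
    moreover have "(\<Sum>i\<in>\<sigma>. ?c i * (v i \<bullet> y)\<^sup>2) = (\<Sum>i\<in>\<sigma>. c i * (v i \<bullet> y)\<^sup>2)"
      using j by (intro sum.cong) auto
    ultimately show ?thesis
      using fin j power2_norm_eq_inner[of y]
      by (simp add: frame_op_form s_def power2_eq_square mult.assoc)
  qed
qed

text \<open>The resolvent at \<open>b\<close> maps the span of the chosen vectors to itself, and there \<open>A \<ge> b\<close>. Hence
  a vector with positive value of this form is a new one.\<close>

lemma resolvent_nonpos_on_family:
  assumes bar: "between_barriers v c \<sigma> b u" and fin: "finite \<sigma>" and b: "0 < b"
    and R: "is_resolvent (frame_op v c \<sigma>) b R" and j: "j \<in> \<sigma>"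
  shows "v j \<bullet> R (v j) \<le> 0"
proof -
  let ?A = "frame_op v c \<sigma>"
  define z where "z = R (v j)"
  have z: "b *\<^sub>R z - ?A z = v j" using is_resolventD(2)[OF R] by (simp add: z_def)
  then have "b *\<^sub>R z = v j + ?A z" by (simp add: algebra_simps)
  then have "z = (1 / b) *\<^sub>R (v j + ?A z)" using b by (metis scaleR_scaleR scaleR_one divide_self_if times_divide_eq_left mult_1 less_irrefl)
  then have "z \<in> span (v ` \<sigma>)"
    by (metis frame_op_in_span imageI j span_add span_base span_scale)
  from frame_op_lower_on_span[OF bar fin b this] have "b * (z \<bullet> z) - z \<bullet> ?A z \<le> 0" by simp
  moreover have "(b *\<^sub>R z - ?A z) \<bullet> z = b * (z \<bullet> z) - z \<bullet> ?A z"
    by (simp add: inner_diff_left frame_op_selfadjoint)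
  ultimately show ?thesis unfolding z by (simp add: z_def)
qed

section \<open>Moving the barriers\<close>

text \<open>The projections of the vectors to a subspace carry at most its dimension in mass, by the
  Bessel inequality applied to an orthonormal basis of the subspace.\<close>

lemma residual_mass:
  fixes v :: "'j \<Rightarrow> 'a::euclidean_space"
  assumes fin: "finite \<sigma>"
    and bessel: "\<And>x. (\<Sum>j\<in>J. (v j \<bullet> x)\<^sup>2) \<le> x \<bullet> x"
    and v: "\<And>j. j \<in> J \<Longrightarrow> v j = q j + p j"
    and q: "\<And>j. j \<in> J \<Longrightarrow> q j \<in> span (v ` \<sigma>)"
    and p: "\<And>j e. j \<in> J \<Longrightarrow> e \<in> span (v ` \<sigma>) \<Longrightarrow> orthogonal (p j) e"
  shows "(\<Sum>j\<in>J. (norm (v j))\<^sup>2) - card \<sigma> \<le> (\<Sum>j\<in>J. (norm (p j))\<^sup>2)"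
proof -
  obtain B where B: "B \<subseteq> span (v ` \<sigma>)" "pairwise orthogonal B" "\<And>x. x \<in> B \<Longrightarrow> norm x = 1"
      "independent B" "card B = dim (span (v ` \<sigma>))" "span B = span (v ` \<sigma>)"
    using orthonormal_basis_subspace[of "span (v ` \<sigma>)"] by auto
  have finB: "finite B" using B(4) by (rule independent_imp_finite)
  have "(norm (q j))\<^sup>2 = (\<Sum>e\<in>B. (v j \<bullet> e)\<^sup>2)" if j: "j \<in> J" for j
  proof -
    have "(\<Sum>e\<in>B. (q j \<bullet> e) *\<^sub>R e) = q j"
      using orthonormal_basis_expand[OF B(2,3) _ finB] q[OF j] B(6) by auto
    then have "q j \<bullet> q j = q j \<bullet> (\<Sum>e\<in>B. (q j \<bullet> e) *\<^sub>R e)" by simp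
    also have "\<dots> = (\<Sum>e\<in>B. (q j \<bullet> e)\<^sup>2)"
      by (simp add: inner_sum_right power2_eq_square)
    also have "\<dots> = (\<Sum>e\<in>B. (v j \<bullet> e)\<^sup>2)"
    proof (intro sum.cong refl)
      fix e assume "e \<in> B"
      then have "p j \<bullet> e = 0" using p[OF j] B(1) by (auto simp: orthogonal_def)
      then show "(q j \<bullet> e)\<^sup>2 = (v j \<bullet> e)\<^sup>2" by (simp add: v[OF j] inner_add_left)
    qed
    finally show ?thesis by (simp add: power2_norm_eq_inner)
  qed
  then have "(\<Sum>j\<in>J. (norm (q j))\<^sup>2) = (\<Sum>j\<in>J. \<Sum>e\<in>B. (v j \<bullet> e)\<^sup>2)" by simp
  also have "\<dots> = (\<Sum>e\<in>B. \<Sum>j\<in>J. (v j \<bullet> e)\<^sup>2)" by (rule sum.swap)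
  also have "\<dots> \<le> (\<Sum>e\<in>B. e \<bullet> e)" by (intro sum_mono bessel)
  also have "\<dots> = (\<Sum>e\<in>B. 1)"
    by (intro sum.cong refl) (simp add: B(3) power2_norm_eq_inner[symmetric])
  also have "\<dots> \<le> card \<sigma>"
    using B(5) dim_le_card'[of "v ` \<sigma>"] card_image_le[OF fin, of v] fin
    by (simp add: dim_span)
  finally have "(\<Sum>j\<in>J. (norm (q j))\<^sup>2) \<le> card \<sigma>" .
  moreover have "(norm (v j))\<^sup>2 = (norm (q j))\<^sup>2 + (norm (p j))\<^sup>2" if j: "j \<in> J" for j
    unfolding v[OF j] using p[OF j q[OF j]]
    by (intro norm_add_Pythagorean) (simp add: orthogonal_commute)
  ultimately show ?thesis by (simp add: sum.distrib)
qed

lemma sum_leverage_le: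
  assumes bessel: "\<And>x. (\<Sum>j\<in>J. (v j \<bullet> x)\<^sup>2) \<le> x \<bullet> x"
  shows "(\<Sum>j\<in>J. leverage J v R (v j)) \<le> (\<Sum>j\<in>J. (norm (R (v j)))\<^sup>2)"
  unfolding leverage_def power2_norm_eq_inner by (intro sum_mono bessel)

text \<open>By the Bessel inequality the total leverage is at most \<open>\<Sum>\<^sub>j \<parallel>R' v\<^sub>j\<parallel>\<^sup>2\<close>, and moving the barrier gains
  at least \<open>\<delta>\<close> times this sum.\<close>

lemma upper_barrier_shift:
  assumes bar: "between_barriers v c \<sigma> b u" and \<delta>: "0 < \<delta>"
    and bessel: "\<And>x. (\<Sum>j\<in>J. (v j \<bullet> x)\<^sup>2) \<le> x \<bullet> x"
    and R: "is_resolvent (frame_op v c \<sigma>) u R" and R': "is_resolvent (frame_op v c \<sigma>) (u + \<delta>) R'"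
    and fin: "finite J" and mass: "0 < (\<Sum>j\<in>J. (norm (v j))\<^sup>2)"
  defines "\<Delta> \<equiv> potential J v R - potential J v R'"
  shows "0 < \<Delta>" "(\<Sum>j\<in>J. leverage J v R' (v j)) / \<Delta> \<le> 1 / \<delta>"
proof -
  let ?A = "frame_op v c \<sigma>"
  define M where "M x = u *\<^sub>R x - ?A x" for x
  define N where "N = (\<Sum>j\<in>J. (norm (R' (v j)))\<^sup>2)"
  have linM: "linear M"
    unfolding M_def by (intro linear_compose_sub linear_scale_self linear_frame_op)
  have saM: "M x \<bullet> y = x \<bullet> M y" for x y
    by (simp add: M_def inner_diff_left inner_diff_right frame_op_selfadjoint)
  have pos: "0 \<le> M x \<bullet> x" for x
    using bar by (simp add: M_def inner_diff_left frame_op_selfadjoint frame_op_form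
        between_barriers_def power2_norm_eq_inner)
  have gain: "\<delta> * (norm (R' (v j)))\<^sup>2 \<le> v j \<bullet> R (v j) - v j \<bullet> R' (v j)" for j
    unfolding power2_norm_eq_inner
    using is_resolventD(2)[OF R, of "v j"] is_resolventD(2)[OF R', of "v j"]
    by (intro resolvent_shift_gain[OF linM saM _ _ pos]) (simp_all add: M_def algebra_simps)
  then have \<Delta>: "\<delta> * N \<le> \<Delta>"
    unfolding \<Delta>_def potential_def N_def sum_distrib_left sum_subtractf[symmetric]
    by (intro sum_mono)
  have "N \<noteq> 0"
  proof
    assume "N = 0"
    then have "\<forall>j\<in>J. R' (v j) = 0"
      unfolding N_def using fin by (simp add: sum_nonneg_eq_0_iff)
    moreover have "v j = 0" if "R' (v j) = 0" for j
      using is_resolventD(2)[OF R', of "v j"] that linear_0[OF linear_frame_op[of v c \<sigma>]] by simp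
    ultimately have "\<forall>j\<in>J. v j = 0" by simp
    then show False using mass by simp
  qed
  moreover have "0 \<le> N" unfolding N_def by (intro sum_nonneg) auto
  ultimately have "0 < N" by simp
  with \<Delta> \<delta> show "0 < \<Delta>" by (smt (verit) mult_pos_pos)
  have "(\<Sum>j\<in>J. leverage J v R' (v j)) \<le> N"
    unfolding N_def by (rule sum_leverage_le[OF bessel])
  also have "N \<le> \<Delta> / \<delta>" using \<Delta> \<delta> by (simp add: field_simps)
  finally show "(\<Sum>j\<in>J. leverage J v R' (v j)) / \<Delta> \<le> 1 / \<delta>"
    using \<open>0 < \<Delta>\<close> \<delta> by (simp add: field_simps)
qed

text \<open>On the span of the chosen vectors the argument is the same as for the upper barrier. On the
  orthogonal complement, where \<open>A = 0\<close>, it fails: with \<open>b' = b - \<delta>\<close> and \<open>\<tau>\<close> the mass of the projections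
  to it, the bound for the total leverage contains \<open>\<tau> / b'\<^sup>2\<close> but \<open>\<Delta> / \<delta>\<close> only \<open>\<tau> / (b b')\<close>. The
  difference \<open>\<delta> \<tau> / (b b'\<^sup>2)\<close> is absorbed by \<open>\<Delta>\<^sup>2 \<ge> (\<delta> \<tau> / (b b'))\<^sup>2\<close> whenever \<open>b \<le> \<delta> \<tau>\<close>. Assumption
  \<open>room\<close> guarantees this, because \<open>\<tau>\<close> is at least the total mass minus the number of chosen vectors.
  The term \<open>\<Delta>\<close> on the right of the second claim is harmless: it is what moving the barrier has added
  to the potential.\<close>

lemma lower_barrier_shift:
  fixes v :: "'j \<Rightarrow> 'a::euclidean_space"
  assumes bar: "between_barriers v c \<sigma> b u" and \<delta>: "0 < \<delta>" "\<delta> < b"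
    and bessel: "\<And>x. (\<Sum>j\<in>J. (v j \<bullet> x)\<^sup>2) \<le> x \<bullet> x"
    and R: "is_resolvent (frame_op v c \<sigma>) b R" and R': "is_resolvent (frame_op v c \<sigma>) (b - \<delta>) R'"
    and fin: "finite \<sigma>"
    and room: "b \<le> \<delta> * ((\<Sum>j\<in>J. (norm (v j))\<^sup>2) - card \<sigma>)"
  defines "\<Delta> \<equiv> potential J v R' - potential J v R"
  shows "0 < \<Delta>" "(\<Sum>j\<in>J. leverage J v R' (v j)) / \<Delta> \<le> 1 / \<delta> + \<Delta>"
proof -
  let ?A = "frame_op v c \<sigma>" and ?E = "span (v ` \<sigma>)"
  define b' where "b' = b - \<delta>"
  have b: "0 < b" and b': "0 < b'" using \<delta> by (auto simp: b'_def)
  have "\<forall>j. \<exists>q p. q \<in> ?E \<and> (\<forall>e\<in>?E. orthogonal p e) \<and> v j = q + p"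
    by (metis orthogonal_subspace_decomp_exists)
  then obtain q p where qp: "\<And>j. q j \<in> ?E" "\<And>j e. e \<in> ?E \<Longrightarrow> orthogonal (p j) e"
      "\<And>j. v j = q j + p j" by metis
  define \<tau> where "\<tau> = (\<Sum>j\<in>J. (norm (p j))\<^sup>2)"
  have "b \<le> \<delta> * \<tau>"
    unfolding \<tau>_def using room residual_mass[OF fin bessel qp(3,1,2)] \<delta>(1)
    by (meson mult_left_mono order_trans less_imp_le)
  then have "0 < \<delta> * \<tau>" using b by linarith
  then have \<tau>: "0 < \<tau>" using \<delta>(1) by (simp add: zero_less_mult_iff)
  have Ap: "?A (p j) = 0" for j using qp(2) by (intro frame_op_orthogonal) auto
  \<comment> \<open>On the span the resolvent acts inside the span, on its complement it is division by the
     barrier.\<close>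
  have split: "\<exists>e\<in>?E. S (v j) = e + (1 / t) *\<^sub>R p j \<and> t *\<^sub>R e - ?A e = q j"
    if S: "is_resolvent ?A t S" and t: "0 < t" for S t j
  proof -
    define e where "e = S (v j) - (1 / t) *\<^sub>R p j"
    have e: "t *\<^sub>R e - ?A e = q j"
      using is_resolventD(2)[OF S, of "v j"] t
      by (simp add: e_def linear_diff[OF linear_frame_op] linear_scale[OF linear_frame_op] Ap
          qp(3)[of j] scaleR_diff_right) (simp add: algebra_simps)
    then have "t *\<^sub>R e \<in> ?E"
      using qp(1)[of j] frame_op_in_span[of v c \<sigma> e] by (metis diff_add_cancel span_add)
    then have "e \<in> ?E" using t by (metis span_scale scaleR_scaleR scaleR_one left_inverse less_irrefl)
    with e show ?thesis by (intro bexI[of _ e]) (auto simp: e_def)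
  qed
  obtain e where e: "\<And>j. e j \<in> ?E" "\<And>j. R (v j) = e j + (1 / b) *\<^sub>R p j"
      "\<And>j. b *\<^sub>R e j - ?A (e j) = q j"
    using split[OF R b] by metis
  obtain e' where e': "\<And>j. e' j \<in> ?E" "\<And>j. R' (v j) = e' j + (1 / b') *\<^sub>R p j"
      "\<And>j. b' *\<^sub>R e' j - ?A (e' j) = q j"
    using split[OF R'[folded b'_def] b'] by metis
  define X where "X = (\<Sum>j\<in>J. (norm (e' j))\<^sup>2)"
  have orth: "p j \<bullet> y = 0" "y \<bullet> p j = 0" if "y \<in> ?E" for j y
    using qp(2)[OF that] by (auto simp: orthogonal_def inner_commute)
  have gain: "\<delta> * (norm (e' j))\<^sup>2 + (1 / b' - 1 / b) * (norm (p j))\<^sup>2 \<le> v j \<bullet> R' (v j) - v j \<bullet> R (v j)" for j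
  proof -
    define M where "M x = ?A x - b *\<^sub>R x" for x
    have linM: "linear M"
      unfolding M_def by (intro linear_compose_sub linear_scale_self linear_frame_op)
    have saM: "M x \<bullet> y = x \<bullet> M y" for x y
      by (simp add: M_def inner_diff_left inner_diff_right frame_op_selfadjoint)
    have "e j - e' j \<in> ?E" using e(1) e'(1) by (rule span_diff)
    from frame_op_lower_on_span[OF bar fin b this]
    have "0 \<le> M (e j - e' j) \<bullet> (e j - e' j)"
      by (simp add: M_def inner_diff_left[of "?A _"] frame_op_selfadjoint)
    moreover have "M (e j) = - q j" using e(3)[of j] by (simp add: M_def algebra_simps)
    moreover have "M (e' j) + \<delta> *\<^sub>R e' j = - q j"
      using e'(3)[of j] by (simp add: M_def b'_def algebra_simps)
    ultimately have "\<delta> * (e' j \<bullet> e' j) \<le> (- q j) \<bullet> e j - (- q j) \<bullet> e' j"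
      by (intro resolvent_shift_gain[OF linM saM])
    moreover have "v j \<bullet> R (v j) = q j \<bullet> e j + (1 / b) * (norm (p j))\<^sup>2"
      by (simp only: e(2)) (simp add: qp(3)[of j] inner_add_left inner_add_right orth qp(1) e(1)
          power2_norm_eq_inner)
    moreover have "v j \<bullet> R' (v j) = q j \<bullet> e' j + (1 / b') * (norm (p j))\<^sup>2"
      by (simp only: e'(2)) (simp add: qp(3)[of j] inner_add_left inner_add_right orth qp(1) e'(1)
          power2_norm_eq_inner)
    ultimately show ?thesis by (simp add: power2_norm_eq_inner algebra_simps)
  qed
  then have "(\<Sum>j\<in>J. \<delta> * (norm (e' j))\<^sup>2 + (1 / b' - 1 / b) * (norm (p j))\<^sup>2) \<le> \<Delta>"
    unfolding \<Delta>_def potential_def sum_subtractf[symmetric] by (intro sum_mono)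
  then have "\<delta> * X + (1 / b' - 1 / b) * \<tau> \<le> \<Delta>"
    by (simp add: sum.distrib X_def \<tau>_def sum_distrib_left)
  moreover have "1 / b' - 1 / b = \<delta> / (b * b')"
    using b b' by (simp add: field_simps b'_def)
  ultimately have \<Delta>: "\<delta> * X + \<delta> * \<tau> / (b * b') \<le> \<Delta>" by simp
  have X: "0 \<le> X" unfolding X_def by (intro sum_nonneg) auto
  have p1: "0 < \<delta> * \<tau> / (b * b')" using \<tau> b b' \<delta> by simp
  then show \<Delta>pos: "0 < \<Delta>" using \<Delta> X \<delta> by (smt (verit) mult_nonneg_nonneg)
  have "(norm (R' (v j)))\<^sup>2 = (norm (e' j))\<^sup>2 + (norm (p j))\<^sup>2 / b'\<^sup>2" for j
    unfolding e'(2) power2_norm_eq_inner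
    by (simp add: inner_add_left inner_add_right orth e'(1) power2_eq_square)
  then have "(\<Sum>j\<in>J. (norm (R' (v j)))\<^sup>2) = X + \<tau> / b'\<^sup>2"
    by (simp add: sum.distrib X_def \<tau>_def sum_divide_distrib)
  then have "(\<Sum>j\<in>J. leverage J v R' (v j)) \<le> X + \<tau> / b'\<^sup>2"
    using sum_leverage_le[where R = R', OF bessel] by simp
  also have "\<tau> / b'\<^sup>2 = \<tau> / (b * b') + \<delta> * \<tau> / (b * b') * (b / (b * b'))"
    using b b' by (simp add: field_simps power2_eq_square) (simp add: b'_def algebra_simps)
  also have "\<dots> \<le> \<tau> / (b * b') + \<delta> * \<tau> / (b * b') * (\<delta> * \<tau> / (b * b'))"
    using p1 \<open>b \<le> \<delta> * \<tau>\<close> b b' by (intro add_left_mono mult_left_mono divide_right_mono) auto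
  also have "\<delta> * \<tau> / (b * b') * (\<delta> * \<tau> / (b * b')) \<le> \<Delta> * \<Delta>"
    using p1 \<Delta> X \<delta> by (intro mult_mono) (auto intro: order_trans[rotated])
  finally have "(\<Sum>j\<in>J. leverage J v R' (v j)) \<le> (X + \<tau> / (b * b')) + \<Delta> * \<Delta>" by simp
  also have "X + \<tau> / (b * b') \<le> \<Delta> / \<delta>" using \<Delta> \<delta>(1) by (simp add: field_simps)
  finally show "(\<Sum>j\<in>J. leverage J v R' (v j)) / \<Delta> \<le> 1 / \<delta> + \<Delta>"
    using \<Delta>pos \<delta> by (simp add: field_simps)
qed

section \<open>Adding one vector\<close>

lemma resolvent_exists_below:
  assumes bar: "between_barriers v c \<sigma> b u" and fin: "finite \<sigma>" and t: "0 < t" "t < b"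
  obtains R where "is_resolvent (frame_op v c \<sigma>) t R"
proof (rule resolvent_exists[OF linear_frame_op])
  fix x assume x: "t *\<^sub>R x - frame_op v c \<sigma> x = 0"
  then have "t *\<^sub>R x \<in> span (v ` \<sigma>)" using frame_op_in_span[of v c \<sigma> x] by simp
  then have "(1 / t) *\<^sub>R t *\<^sub>R x \<in> span (v ` \<sigma>)" by (rule span_scale)
  then have "x \<in> span (v ` \<sigma>)" using t by simp
  with frame_op_lower_on_span[OF bar fin] t have "b * (x \<bullet> x) \<le> x \<bullet> frame_op v c \<sigma> x" by simp
  also have "frame_op v c \<sigma> x = t *\<^sub>R x" using x by simp
  finally have "(b - t) * (x \<bullet> x) \<le> 0" by (simp add: algebra_simps)
  then have "x \<bullet> x \<le> 0" using t by (simp add: mult_le_0_iff)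
  then show "x = 0" by (metis inner_gt_zero_iff not_le)
qed (rule that)

lemma resolvent_exists_above:
  assumes bar: "between_barriers v c \<sigma> b u" and t: "u < t"
  obtains R where "is_resolvent (frame_op v c \<sigma>) t R"
proof (rule resolvent_exists[OF linear_frame_op])
  fix x assume x: "t *\<^sub>R x - frame_op v c \<sigma> x = 0"
  have "x \<bullet> frame_op v c \<sigma> x \<le> u * (x \<bullet> x)"
    using bar by (simp add: between_barriers_def frame_op_form power2_norm_eq_inner)
  also have "frame_op v c \<sigma> x = t *\<^sub>R x" using x by simp
  finally have "(t - u) * (x \<bullet> x) \<le> 0" by (simp add: algebra_simps)
  then have "x \<bullet> x \<le> 0" using t by (simp add: mult_le_0_iff)
  then show "x = 0" by (metis inner_gt_zero_iff not_le)
qed (rule that)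

lemma resolvent_nonneg_above:
  assumes bar: "between_barriers v c \<sigma> b u" and R: "is_resolvent (frame_op v c \<sigma>) u R"
  shows "0 \<le> w \<bullet> R w"
proof -
  have "0 \<le> u * (R w \<bullet> R w) - R w \<bullet> frame_op v c \<sigma> (R w)"
    using bar by (simp add: between_barriers_def frame_op_form power2_norm_eq_inner)
  also have "\<dots> = (u *\<^sub>R R w - frame_op v c \<sigma> (R w)) \<bullet> R w"
    by (simp add: inner_diff_left frame_op_selfadjoint)
  finally show ?thesis using is_resolventD(2)[OF R] by simp
qed

lemma leverage_nonneg: "0 \<le> leverage J v R w"
  unfolding leverage_def by (intro sum_nonneg) auto

lemma resolvent_insert:
  fixes v :: "'j \<Rightarrow> 'a::euclidean_space"
  assumes R: "is_resolvent (frame_op v c \<sigma>) t R" and "finite \<sigma>" "j \<notin> \<sigma>"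
    and "0 < \<gamma>" "v j \<bullet> R (v j) \<noteq> 1 / \<gamma>"
  obtains R' where "is_resolvent (frame_op v (c(j := \<gamma>)) (insert j \<sigma>)) t R'"
    "potential J v R' = potential J v R + leverage J v R (v j) / (1 / \<gamma> - v j \<bullet> R (v j))"
proof -
  define k where "k = \<gamma> / (1 - \<gamma> * (v j \<bullet> R (v j)))"
  have nz: "1 - \<gamma> * (v j \<bullet> R (v j)) \<noteq> 0" using assms(4,5) by (auto simp: field_simps)
  have "1 / \<gamma> - v j \<bullet> R (v j) = (1 - \<gamma> * (v j \<bullet> R (v j))) / \<gamma>"
    using assms(4) by (simp add: field_simps)
  then have k: "k * leverage J v R (v j) = leverage J v R (v j) / (1 / \<gamma> - v j \<bullet> R (v j))"
    by (simp add: k_def)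
  let ?R' = "\<lambda>x. R x + (k * (v j \<bullet> R x)) *\<^sub>R R (v j)"
  have "is_resolvent (frame_op v (c(j := \<gamma>)) (insert j \<sigma>)) t ?R'"
    unfolding frame_op_insert[OF assms(2,3)] k_def
    by (rule sherman_morrison[OF linear_frame_op R nz])
  moreover have "potential J v ?R' = potential J v R + k * leverage J v R (v j)"
    by (intro potential_rank_one resolvent_selfadjoint[OF frame_op_selfadjoint R])
  ultimately show ?thesis using that k by metis
qed

text \<open>\<open>L\<close> and \<open>U\<close> below are the two bounds that \<open>1 / \<gamma>\<close> has to respect; the budget makes the sum of \<open>L\<close>
  exceed that of \<open>U\<close>, so some vector leaves room for \<open>\<gamma>\<close>. The gain from moving each barrier then pays
  for the change of the potential that the new vector causes.\<close>

lemma barrier_step: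
  fixes v :: "'j \<Rightarrow> 'a::euclidean_space"
  assumes fin: "finite J" and \<sigma>: "\<sigma> \<subseteq> J"
    and bessel: "\<And>x. (\<Sum>j\<in>J. (v j \<bullet> x)\<^sup>2) \<le> x \<bullet> x"
    and bar: "between_barriers v c \<sigma> b u"
    and Rb: "is_resolvent (frame_op v c \<sigma>) b Rb" and Ru: "is_resolvent (frame_op v c \<sigma>) u Ru"
    and \<delta>: "0 < \<delta>b" "\<delta>b < b" "0 < \<delta>u"
    and room: "b \<le> \<delta>b * ((\<Sum>j\<in>J. (norm (v j))\<^sup>2) - card \<sigma>)"
    and pot: "Q \<le> potential J v Rb" "potential J v Ru \<le> P"
    and budget: "P + 1 / \<delta>u \<le> Q - 1 / \<delta>b"
  obtains j \<gamma> Rb' Ru' where "j \<in> J" "j \<notin> \<sigma>"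
    "between_barriers v (c(j := \<gamma>)) (insert j \<sigma>) (b - \<delta>b) (u + \<delta>u)"
    "is_resolvent (frame_op v (c(j := \<gamma>)) (insert j \<sigma>)) (b - \<delta>b) Rb'"
    "is_resolvent (frame_op v (c(j := \<gamma>)) (insert j \<sigma>)) (u + \<delta>u) Ru'"
    "Q \<le> potential J v Rb'" "potential J v Ru' \<le> P"
proof -
  have fin\<sigma>: "finite \<sigma>" using fin \<sigma> finite_subset by blast
  have b: "0 < b" "0 < b - \<delta>b" using \<delta> by auto
  obtain S where S: "is_resolvent (frame_op v c \<sigma>) (b - \<delta>b) S"
    using resolvent_exists_below[OF bar fin\<sigma> b(2)] \<delta>(1) by auto
  obtain T where T: "is_resolvent (frame_op v c \<sigma>) (u + \<delta>u) T"
    using resolvent_exists_above[OF bar, of "u + \<delta>u"] \<delta>(3) by auto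
  have bar': "between_barriers v c \<sigma> (b - \<delta>b) (u + \<delta>u)"
    using between_barriers_mono[OF bar] \<delta> by simp
  have "0 < \<delta>b * ((\<Sum>j\<in>J. (norm (v j))\<^sup>2) - card \<sigma>)" using room b(1) by linarith
  then have mass: "0 < (\<Sum>j\<in>J. (norm (v j))\<^sup>2)" using \<delta>(1) by (simp add: zero_less_mult_iff)
  define \<Delta>b where "\<Delta>b = potential J v S - potential J v Rb"
  define \<Delta>u where "\<Delta>u = potential J v Ru - potential J v T"
  note lower = lower_barrier_shift[OF bar \<delta>(1,2) bessel Rb S fin\<sigma> room, folded \<Delta>b_def]
  note upper = upper_barrier_shift[OF bar \<delta>(3) bessel Ru T fin mass, folded \<Delta>u_def]
  define L where "L j = v j \<bullet> S (v j) - leverage J v S (v j) / \<Delta>b" for j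
  define U where "U j = v j \<bullet> T (v j) + leverage J v T (v j) / \<Delta>u" for j
  have "sum L J = potential J v S - (\<Sum>j\<in>J. leverage J v S (v j)) / \<Delta>b"
    by (simp add: L_def potential_def sum_subtractf sum_divide_distrib)
  also have "\<dots> \<ge> Q - 1 / \<delta>b"
    using lower(2) pot(1) by (simp add: \<Delta>b_def)
  finally have sumL: "Q - 1 / \<delta>b \<le> sum L J" .
  have "sum U J = potential J v T + (\<Sum>j\<in>J. leverage J v T (v j)) / \<Delta>u"
    by (simp add: U_def potential_def sum.distrib sum_divide_distrib)
  also have "\<dots> < P + 1 / \<delta>u"
    using upper pot(2) by (simp add: \<Delta>u_def)
  finally have "sum U J < sum L J" using budget sumL by linarith
  then obtain j where j: "j \<in> J" "U j < L j"
    using sum_mono[of J L U] by (meson not_less)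
  have levb: "0 \<le> leverage J v S (v j) / \<Delta>b" and levu: "0 \<le> leverage J v T (v j) / \<Delta>u"
    using leverage_nonneg lower(1) upper(1) by (auto intro!: divide_nonneg_pos)
  have "0 \<le> v j \<bullet> T (v j)" by (rule resolvent_nonneg_above[OF bar' T])
  then have U0: "0 \<le> U j" using levu by (simp add: U_def)
  \<comment> \<open>\<open>1 / \<gamma>\<close> is the midpoint of the admissible interval; being strictly inside keeps the
     updated operators invertible.\<close>
  define \<gamma> where "\<gamma> = 2 / (L j + U j)"
  have \<gamma>: "0 < \<gamma>" "U j < 1 / \<gamma>" "1 / \<gamma> < L j" using U0 j(2) by (auto simp: \<gamma>_def)
  have gapb: "leverage J v S (v j) / \<Delta>b < v j \<bullet> S (v j) - 1 / \<gamma>" using \<gamma>(3) by (simp add: L_def)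
  have gapu: "leverage J v T (v j) / \<Delta>u < 1 / \<gamma> - v j \<bullet> T (v j)" using \<gamma>(2) by (simp add: U_def)
  have posb: "0 < v j \<bullet> S (v j) - 1 / \<gamma>" using gapb levb by linarith
  have posu: "0 < 1 / \<gamma> - v j \<bullet> T (v j)" using gapu levu by linarith
  have j\<sigma>: "j \<notin> \<sigma>"
  proof
    assume "j \<in> \<sigma>"
    from resolvent_nonpos_on_family[OF bar' fin\<sigma> b(2) S this] posb \<gamma>(1) show False
      by (smt (verit) divide_pos_pos)
  qed
  have "between_barriers v (c(j := \<gamma>)) (insert j \<sigma>) (b - \<delta>b) (u + \<delta>u)"
    using posb posu by (intro between_barriers_insert[OF bar' fin\<sigma> j\<sigma> b(2) S T \<gamma>(1)]) auto
  moreover obtain Rb' where Rb': "is_resolvent (frame_op v (c(j := \<gamma>)) (insert j \<sigma>)) (b - \<delta>b) Rb'"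
      "potential J v Rb' = potential J v S + leverage J v S (v j) / (1 / \<gamma> - v j \<bullet> S (v j))"
    using resolvent_insert[OF S fin\<sigma> j\<sigma> \<gamma>(1), where J = J] posb by force
  moreover obtain Ru' where Ru': "is_resolvent (frame_op v (c(j := \<gamma>)) (insert j \<sigma>)) (u + \<delta>u) Ru'"
      "potential J v Ru' = potential J v T + leverage J v T (v j) / (1 / \<gamma> - v j \<bullet> T (v j))"
    using resolvent_insert[OF T fin\<sigma> j\<sigma> \<gamma>(1), where J = J] posu by force
  moreover have "Q \<le> potential J v Rb'"
  proof -
    have "leverage J v S (v j) / (v j \<bullet> S (v j) - 1 / \<gamma>) \<le> \<Delta>b"
      using gapb posb lower(1) by (simp add: pos_divide_le_eq pos_divide_less_eq mult.commute)
    moreover have "leverage J v S (v j) / (1 / \<gamma> - v j \<bullet> S (v j))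
        = - (leverage J v S (v j) / (v j \<bullet> S (v j) - 1 / \<gamma>))"
      by (metis minus_diff_eq minus_divide_right)
    ultimately show ?thesis using pot(1) by (simp add: Rb'(2) \<Delta>b_def)
  qed
  moreover have "potential J v Ru' \<le> P"
  proof -
    have "leverage J v T (v j) / (1 / \<gamma> - v j \<bullet> T (v j)) \<le> \<Delta>u"
      using gapu posu upper(1) by (simp add: pos_divide_le_eq pos_divide_less_eq mult.commute)
    then show ?thesis using pot(2) by (simp add: Ru'(2) \<Delta>u_def)
  qed
  ultimately show ?thesis using that j(1) j\<sigma> by blast
qed

text \<open>For staying between the barriers alone, \<open>1 / \<gamma>\<close> only has to separate the two resolvent forms at
  the new vector; the potentials are their sums over all vectors.\<close>

lemma barrier_last_step:
  fixes v :: "'j \<Rightarrow> 'a::euclidean_space"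
  assumes fin: "finite J" and \<sigma>: "\<sigma> \<subseteq> J"
    and bar: "between_barriers v c \<sigma> b u" and b: "0 < b"
    and Rb: "is_resolvent (frame_op v c \<sigma>) b Rb" and Ru: "is_resolvent (frame_op v c \<sigma>) u Ru"
    and pot: "potential J v Ru < potential J v Rb"
  obtains j \<gamma> where "j \<in> J" "j \<notin> \<sigma>" "between_barriers v (c(j := \<gamma>)) (insert j \<sigma>) b u"
proof -
  have fin\<sigma>: "finite \<sigma>" using fin \<sigma> finite_subset by blast
  obtain j where j: "j \<in> J" "v j \<bullet> Ru (v j) < v j \<bullet> Rb (v j)"
    using pot sum_mono[of J "\<lambda>j. v j \<bullet> Rb (v j)" "\<lambda>j. v j \<bullet> Ru (v j)"]
    unfolding potential_def by (meson not_less)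
  have U0: "0 \<le> v j \<bullet> Ru (v j)" by (rule resolvent_nonneg_above[OF bar Ru])
  define \<gamma> where "\<gamma> = 2 / (v j \<bullet> Ru (v j) + v j \<bullet> Rb (v j))"
  have \<gamma>: "0 < \<gamma>" "v j \<bullet> Ru (v j) < 1 / \<gamma>" "1 / \<gamma> < v j \<bullet> Rb (v j)"
    using U0 j(2) by (auto simp: \<gamma>_def)
  have j\<sigma>: "j \<notin> \<sigma>"
  proof
    assume "j \<in> \<sigma>"
    from resolvent_nonpos_on_family[OF bar fin\<sigma> b Rb this] U0 j(2) show False by linarith
  qed
  have "between_barriers v (c(j := \<gamma>)) (insert j \<sigma>) b u"
    using \<gamma> by (intro between_barriers_insert[OF bar fin\<sigma> j\<sigma> b Rb Ru]) auto
  with that j(1) j\<sigma> show ?thesis by blast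
qed

section \<open>Iterating the step\<close>

text \<open>With \<open>K = (1 - \<epsilon>) H\<close>, the barriers after \<open>i\<close> steps are \<open>\<epsilon> (K - i) / K\<close> and
  \<open>(2 - \<epsilon>) (K + i) / K\<close>. The lower one stays positive as long as \<open>i < K\<close>. The requirement
  \<open>b \<le> \<delta> (H - i)\<close> of the lower shift reads \<open>K - i \<le> H - i\<close>.\<close>

lemma barrier_iterate:
  fixes v :: "'j \<Rightarrow> 'a::euclidean_space"
  assumes fin: "finite J"
    and bessel: "\<And>x. (\<Sum>j\<in>J. (v j \<bullet> x)\<^sup>2) \<le> x \<bullet> x"
    and \<epsilon>: "0 < \<epsilon>" "\<epsilon> < 1"
  defines "H \<equiv> \<Sum>j\<in>J. (norm (v j))\<^sup>2"
  assumes "real i < (1 - \<epsilon>) * H"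
  shows "\<exists>\<sigma> c Rb Ru. \<sigma> \<subseteq> J \<and> card \<sigma> = i \<and>
    between_barriers v c \<sigma> (\<epsilon> * (1 - i / ((1 - \<epsilon>) * H))) ((2 - \<epsilon>) * (1 + i / ((1 - \<epsilon>) * H))) \<and>
    is_resolvent (frame_op v c \<sigma>) (\<epsilon> * (1 - i / ((1 - \<epsilon>) * H))) Rb \<and>
    is_resolvent (frame_op v c \<sigma>) ((2 - \<epsilon>) * (1 + i / ((1 - \<epsilon>) * H))) Ru \<and>
    H / \<epsilon> \<le> potential J v Rb \<and> potential J v Ru \<le> H / (2 - \<epsilon>)"
  using assms(6)
proof (induction i)
  case 0
  have res: "is_resolvent (frame_op v (\<lambda>_. 1) {}) t (\<lambda>x. (1 / t) *\<^sub>R x)" if "0 < t" for t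
    unfolding is_resolvent_def using that by (auto simp: frame_op_def intro: linear_scale_self)
  have pot: "potential J v (\<lambda>x. (1 / t) *\<^sub>R x) = H / t" for t
    by (simp add: potential_def H_def power2_norm_eq_inner sum_divide_distrib)
  have "between_barriers v (\<lambda>_. 1) {} \<epsilon> (2 - \<epsilon>)"
    using \<epsilon> by (simp add: between_barriers_def)
  then show ?case
    using res[of \<epsilon>] res[of "2 - \<epsilon>"] pot[of \<epsilon>] pot[of "2 - \<epsilon>"] \<epsilon>
    by (intro exI[of _ "{}"] exI[of _ "\<lambda>_. 1"] exI[of _ "\<lambda>x. (1 / \<epsilon>) *\<^sub>R x"]
        exI[of _ "\<lambda>x. (1 / (2 - \<epsilon>)) *\<^sub>R x"]) simp
next
  case (Suc i)
  define K where "K = (1 - \<epsilon>) * H"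
  have iK: "real i + 1 < K" using Suc.prems by (simp add: K_def)
  then have K: "0 < K" by linarith
  then have H: "0 < H" using \<epsilon> by (simp add: K_def zero_less_mult_iff)
  have KH: "K \<le> H" using H \<epsilon> by (simp add: K_def algebra_simps)
  define b where "b = \<epsilon> * (1 - i / K)"
  define u where "u = (2 - \<epsilon>) * (1 + i / K)"
  obtain \<sigma> c Rb Ru where st: "\<sigma> \<subseteq> J" "card \<sigma> = i" "between_barriers v c \<sigma> b u"
      "is_resolvent (frame_op v c \<sigma>) b Rb" "is_resolvent (frame_op v c \<sigma>) u Ru"
      "H / \<epsilon> \<le> potential J v Rb" "potential J v Ru \<le> H / (2 - \<epsilon>)"
    using Suc.IH iK unfolding K_def[symmetric] b_def u_def by auto
  have \<delta>u: "0 < (2 - \<epsilon>) / K" using \<epsilon> K by simp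
  have "\<epsilon> * (real i + 1) < \<epsilon> * K" using \<epsilon>(1) iK by simp
  then have \<delta>b: "0 < \<epsilon> / K" "\<epsilon> / K < b"
    using \<epsilon> K by (auto simp: b_def field_simps)
  have "b = \<epsilon> / K * (K - i)" using K by (simp add: b_def field_simps)
  also have "\<dots> \<le> \<epsilon> / K * (H - card \<sigma>)"
    using KH \<delta>b(1) st(2) by (intro mult_left_mono) auto
  finally have room: "b \<le> \<epsilon> / K * ((\<Sum>j\<in>J. (norm (v j))\<^sup>2) - card \<sigma>)" by (simp add: H_def)
  have "H + K = H * (2 - \<epsilon>)" by (simp add: K_def algebra_simps)
  then have "H / (2 - \<epsilon>) + 1 / ((2 - \<epsilon>) / K) = H"
    using \<epsilon> by (simp add: add_divide_distrib[symmetric])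
  moreover have "H / \<epsilon> - 1 / (\<epsilon> / K) = H"
    using \<epsilon> by (simp add: K_def field_simps)
  ultimately have budget: "H / (2 - \<epsilon>) + 1 / ((2 - \<epsilon>) / K) \<le> H / \<epsilon> - 1 / (\<epsilon> / K)" by simp
  have shifted: "b - \<epsilon> / K = \<epsilon> * (1 - Suc i / K)" "u + (2 - \<epsilon>) / K = (2 - \<epsilon>) * (1 + Suc i / K)"
    using K by (simp_all add: b_def u_def field_simps)
  obtain j \<gamma> Rb' Ru' where new: "j \<in> J" "j \<notin> \<sigma>"
      "between_barriers v (c(j := \<gamma>)) (insert j \<sigma>) (b - \<epsilon> / K) (u + (2 - \<epsilon>) / K)"
      "is_resolvent (frame_op v (c(j := \<gamma>)) (insert j \<sigma>)) (b - \<epsilon> / K) Rb'"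
      "is_resolvent (frame_op v (c(j := \<gamma>)) (insert j \<sigma>)) (u + (2 - \<epsilon>) / K) Ru'"
      "H / \<epsilon> \<le> potential J v Rb'" "potential J v Ru' \<le> H / (2 - \<epsilon>)"
    by (rule barrier_step[OF fin st(1) bessel st(3,4,5) \<delta>b \<delta>u room st(6,7) budget])
  have "card (insert j \<sigma>) = Suc i" using new(2) st(1,2) fin finite_subset by (metis card_insert_disjoint)
  then show ?case
    using new st(1) unfolding K_def[symmetric] shifted[symmetric] by (metis insert_subset)
qed

text \<open>The number \<open>l\<close> of regular steps is the largest integer strictly below \<open>(1 - \<epsilon>)\<^sup>2 H\<close>, which keeps
  the barriers within \<open>\<epsilon>\<^sup>2\<close> and \<open>(2 - \<epsilon>)\<^sup>2\<close>; the last step provides the missing vector.\<close>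

lemma barrier_selection:
  fixes v :: "'j \<Rightarrow> 'a::euclidean_space"
  assumes fin: "finite J"
    and bessel: "\<And>x. (\<Sum>j\<in>J. (v j \<bullet> x)\<^sup>2) \<le> x \<bullet> x"
    and \<epsilon>: "0 < \<epsilon>" "\<epsilon> < 1" and mass: "0 < (\<Sum>j\<in>J. (norm (v j))\<^sup>2)"
  shows "\<exists>\<sigma> c. \<sigma> \<subseteq> J \<and> (1 - \<epsilon>)\<^sup>2 * (\<Sum>j\<in>J. (norm (v j))\<^sup>2) \<le> card \<sigma> \<and>
    between_barriers v c \<sigma> (\<epsilon>\<^sup>2) ((2 - \<epsilon>)\<^sup>2)"
proof -
  define H where "H = (\<Sum>j\<in>J. (norm (v j))\<^sup>2)"
  define K where "K = (1 - \<epsilon>) * H"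
  have H: "0 < H" using mass by (simp add: H_def)
  have K: "0 < K" using H \<epsilon> by (simp add: K_def)
  define l where "l = nat \<lceil>(1 - \<epsilon>) * K\<rceil> - 1"
  have "0 < (1 - \<epsilon>) * K" using K \<epsilon> by simp
  then have l: "real l < (1 - \<epsilon>) * K" "(1 - \<epsilon>) * K \<le> real (Suc l)"
    unfolding l_def by linarith+
  have "(1 - \<epsilon>) * K < K" using K \<epsilon> by (simp add: algebra_simps)
  with l(1) have lK: "real l < K" by linarith
  define b where "b = \<epsilon> * (1 - l / K)"
  define u where "u = (2 - \<epsilon>) * (1 + l / K)"
  obtain \<sigma> c Rb Ru where st: "\<sigma> \<subseteq> J" "card \<sigma> = l" "between_barriers v c \<sigma> b u"
      "is_resolvent (frame_op v c \<sigma>) b Rb" "is_resolvent (frame_op v c \<sigma>) u Ru"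
      "H / \<epsilon> \<le> potential J v Rb" "potential J v Ru \<le> H / (2 - \<epsilon>)"
    using barrier_iterate[OF fin bessel \<epsilon>, of l] lK
    unfolding H_def[symmetric] K_def[symmetric] b_def[symmetric] u_def[symmetric] by auto
  have lK': "l / K \<le> 1 - \<epsilon>" using l(1) K by (simp add: field_simps)
  then have "\<epsilon> * \<epsilon> \<le> b" unfolding b_def using \<epsilon> by (intro mult_left_mono) auto
  moreover have "u \<le> (2 - \<epsilon>) * (2 - \<epsilon>)" unfolding u_def using \<epsilon> lK' by (intro mult_left_mono) auto
  ultimately have bu: "\<epsilon>\<^sup>2 \<le> b" "u \<le> (2 - \<epsilon>)\<^sup>2" by (simp_all add: power2_eq_square)
  have "H / (2 - \<epsilon>) < H / \<epsilon>" using H \<epsilon> by (simp add: divide_strict_left_mono)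
  then have "potential J v Ru < potential J v Rb" using st(6,7) by linarith
  moreover have "0 < b" using bu(1) \<epsilon> by (smt (verit) zero_less_power)
  ultimately obtain j \<gamma> where new: "j \<in> J" "j \<notin> \<sigma>"
      "between_barriers v (c(j := \<gamma>)) (insert j \<sigma>) b u"
    using barrier_last_step[OF fin st(1,3) _ st(4,5)] by metis
  have "card (insert j \<sigma>) = Suc l" using new(2) st(1,2) fin finite_subset by (metis card_insert_disjoint)
  then have "(1 - \<epsilon>)\<^sup>2 * H \<le> card (insert j \<sigma>)"
    using l(2) by (simp add: K_def power2_eq_square mult.assoc)
  moreover have "between_barriers v (c(j := \<gamma>)) (insert j \<sigma>) (\<epsilon>\<^sup>2) ((2 - \<epsilon>)\<^sup>2)"
    using between_barriers_mono[OF new(3) bu] .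
  moreover have "insert j \<sigma> \<subseteq> J" using new(1) st(1) by simp
  ultimately show ?thesis unfolding H_def by metis
qed

section \<open>Removing the weights\<close>

text \<open>Let \<open>G\<close> be the Gram matrix of the normalized vectors and \<open>D\<close> the diagonal matrix of
  \<open>s\<^sub>j = c\<^sub>j \<parallel>v\<^sub>j\<parallel>\<^sup>2\<close>. The barriers say that \<open>sqrt D G sqrt D\<close> lies between \<open>b\<close> and \<open>u\<close>, hence
  \<open>b D\<^sup>-\<^sup>1 \<le> G \<le> u D\<^sup>-\<^sup>1\<close>. The diagonal entries of \<open>sqrt D G sqrt D\<close> are the \<open>s\<^sub>j\<close>, so these lie between \<open>b\<close>
  and \<open>u\<close> too.\<close>

lemma unweight:
  fixes v :: "'j \<Rightarrow> 'a::euclidean_space"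
  assumes bar: "between_barriers v c \<sigma> b u" and fin: "finite \<sigma>" and b: "0 < b" and u: "0 < u"
  shows "\<And>j. j \<in> \<sigma> \<Longrightarrow> v j \<noteq> 0"
    and "b / u * (\<Sum>j\<in>\<sigma>. (a j)\<^sup>2) \<le> (norm (\<Sum>j\<in>\<sigma>. a j *\<^sub>R sgn (v j)))\<^sup>2"
    and "(norm (\<Sum>j\<in>\<sigma>. a j *\<^sub>R sgn (v j)))\<^sup>2 \<le> u / b * (\<Sum>j\<in>\<sigma>. (a j)\<^sup>2)"
proof -
  define s where "s j = c j * (norm (v j))\<^sup>2" for j
  have c: "0 < c j" if "j \<in> \<sigma>" for j using bar that by (simp add: between_barriers_def)
  have lo: "b * (\<Sum>j\<in>\<sigma>. (x j)\<^sup>2 / c j) \<le> (norm (\<Sum>j\<in>\<sigma>. x j *\<^sub>R v j))\<^sup>2" for x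
    using bar by (simp add: between_barriers_def)
  have up: "(\<Sum>j\<in>\<sigma>. c j * (v j \<bullet> y)\<^sup>2) \<le> u * (norm y)\<^sup>2" for y
    using bar by (simp add: between_barriers_def)
  have bs: "b \<le> s j" if j: "j \<in> \<sigma>" for j
  proof -
    have "(\<Sum>i\<in>\<sigma>. (if i = j then 1 else 0)\<^sup>2 / c i) = (\<Sum>i\<in>\<sigma>. if i = j then 1 / c j else 0)"
      by (intro sum.cong) auto
    moreover have "(\<Sum>i\<in>\<sigma>. (if i = j then 1 else 0) *\<^sub>R v i) = (\<Sum>i\<in>\<sigma>. if i = j then v j else 0)"
      by (intro sum.cong) auto
    ultimately have "b * (1 / c j) \<le> (norm (v j))\<^sup>2"
      using lo[of "\<lambda>i. if i = j then 1 else 0"] fin j by simp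
    then show ?thesis using c[OF j] by (simp add: s_def field_simps)
  qed
  have s0: "0 < s j" if "j \<in> \<sigma>" for j using bs[OF that] b by linarith
  then show v0: "v j \<noteq> 0" if "j \<in> \<sigma>" for j using that by (force simp: s_def)
  have su: "s j \<le> u" if j: "j \<in> \<sigma>" for j
  proof -
    have "c j * (v j \<bullet> v j)\<^sup>2 \<le> (\<Sum>i\<in>\<sigma>. c i * (v i \<bullet> v j)\<^sup>2)"
      using fin j c by (intro member_le_sum) (auto simp: less_imp_le)
    also have "\<dots> \<le> u * (norm (v j))\<^sup>2" by (rule up)
    finally have "s j * (norm (v j))\<^sup>2 \<le> u * (norm (v j))\<^sup>2"
      unfolding s_def power2_norm_eq_inner by (simp add: power2_eq_square mult.assoc)
    then show ?thesis using v0[OF j] by simp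
  qed
  define y where "y = (\<Sum>j\<in>\<sigma>. a j *\<^sub>R sgn (v j))"
  define D where "D = (\<Sum>j\<in>\<sigma>. (a j)\<^sup>2 / s j)"
  have "b * (\<Sum>j\<in>\<sigma>. (a j / norm (v j))\<^sup>2 / c j) \<le> (norm (\<Sum>j\<in>\<sigma>. (a j / norm (v j)) *\<^sub>R v j))\<^sup>2"
    by (rule lo)
  moreover have "(\<Sum>j\<in>\<sigma>. (a j / norm (v j))\<^sup>2 / c j) = D"
    unfolding D_def s_def by (intro sum.cong) (auto simp: power_divide mult.commute)
  moreover have "(\<Sum>j\<in>\<sigma>. (a j / norm (v j)) *\<^sub>R v j) = y"
    unfolding y_def sgn_div_norm by (intro sum.cong) (auto simp: divide_inverse)
  ultimately have D: "b * D \<le> (norm y)\<^sup>2" by simp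
  have "b / u * (\<Sum>j\<in>\<sigma>. (a j)\<^sup>2) = b * (\<Sum>j\<in>\<sigma>. (a j)\<^sup>2 / u)"
    by (simp flip: sum_divide_distrib)
  also have "\<dots> \<le> b * D"
    unfolding D_def using b su s0 by (intro mult_left_mono sum_mono divide_left_mono) (auto simp: u)
  also note D
  finally show "b / u * (\<Sum>j\<in>\<sigma>. (a j)\<^sup>2) \<le> (norm (\<Sum>j\<in>\<sigma>. a j *\<^sub>R sgn (v j)))\<^sup>2"
    by (simp add: y_def)
  have "D \<le> (\<Sum>j\<in>\<sigma>. (a j)\<^sup>2 / b)"
    unfolding D_def using b bs s0 by (intro sum_mono divide_left_mono) auto
  then have Db: "D \<le> (\<Sum>j\<in>\<sigma>. (a j)\<^sup>2) / b" by (simp add: sum_divide_distrib)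
  have D0: "0 \<le> D" unfolding D_def using s0 by (intro sum_nonneg) (auto simp: less_imp_le)
  have "(norm y)\<^sup>2 = (\<Sum>j\<in>\<sigma>. a j * (sgn (v j) \<bullet> y))"
    unfolding power2_norm_eq_inner by (subst (1) y_def) (simp add: inner_sum_left)
  also have "\<dots> = (\<Sum>j\<in>\<sigma>. (a j / sqrt (s j)) * (sqrt (s j) * (sgn (v j) \<bullet> y)))"
    by (intro sum.cong refl) (use s0 in \<open>force\<close>)
  finally have "((norm y)\<^sup>2)\<^sup>2 \<le> (\<Sum>j\<in>\<sigma>. (a j / sqrt (s j))\<^sup>2) * (\<Sum>j\<in>\<sigma>. (sqrt (s j) * (sgn (v j) \<bullet> y))\<^sup>2)"
    using Cauchy_Schwarz_ineq_sum[of "\<lambda>j. a j / sqrt (s j)" "\<lambda>j. sqrt (s j) * (sgn (v j) \<bullet> y)" \<sigma>] by simp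
  also have "(\<Sum>j\<in>\<sigma>. (a j / sqrt (s j))\<^sup>2) = D"
    unfolding D_def by (intro sum.cong refl) (simp add: power_divide less_imp_le s0)
  also have "(\<Sum>j\<in>\<sigma>. (sqrt (s j) * (sgn (v j) \<bullet> y))\<^sup>2) = (\<Sum>j\<in>\<sigma>. c j * (v j \<bullet> y)\<^sup>2)"
  proof (intro sum.cong refl)
    fix j assume j: "j \<in> \<sigma>"
    then have "(sqrt (s j) * (sgn (v j) \<bullet> y))\<^sup>2 = s j * (sgn (v j) \<bullet> y)\<^sup>2"
      by (simp add: power_mult_distrib less_imp_le s0)
    also have "\<dots> = c j * (v j \<bullet> y)\<^sup>2"
      using v0[OF j] by (simp add: s_def sgn_div_norm field_simps power2_eq_square)
    finally show "(sqrt (s j) * (sgn (v j) \<bullet> y))\<^sup>2 = c j * (v j \<bullet> y)\<^sup>2" .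
  qed
  also have "D * \<dots> \<le> (\<Sum>j\<in>\<sigma>. (a j)\<^sup>2) / b * (u * (norm y)\<^sup>2)"
    using Db D0 up[of y] c by (intro mult_mono sum_nonneg) (auto simp: less_imp_le)
  finally have *: "(norm y)\<^sup>2 * (norm y)\<^sup>2 \<le> (u / b * (\<Sum>j\<in>\<sigma>. (a j)\<^sup>2)) * (norm y)\<^sup>2"
    by (simp add: power2_eq_square[of "(norm y)\<^sup>2"] mult_ac)
  have "(norm y)\<^sup>2 \<le> u / b * (\<Sum>j\<in>\<sigma>. (a j)\<^sup>2)"
  proof (cases "y = 0")
    case True
    then show ?thesis using b u by (simp add: sum_nonneg)
  next
    case False
    then have "0 < (norm y)\<^sup>2" by simp
    with * show ?thesis by (rule mult_right_le_imp_le)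
  qed
  then show "(norm (\<Sum>j\<in>\<sigma>. a j *\<^sub>R sgn (v j)))\<^sup>2 \<le> u / b * (\<Sum>j\<in>\<sigma>. (a j)\<^sup>2)"
    by (simp add: y_def)
qed

section \<open>Columns of a matrix\<close>

lemma hs_norm_columns: "(hs_norm U)\<^sup>2 = (\<Sum>j\<in>UNIV. (norm (column j U))\<^sup>2)"
  for U :: "real^'m^'n"
proof -
  have "(hs_norm U)\<^sup>2 = (\<Sum>i\<in>UNIV. \<Sum>j\<in>UNIV. U $ i $ j * U $ i $ j)"
    unfolding hs_norm_power2 by (simp add: trace_def matrix_matrix_mult_def transpose_def)
  also have "\<dots> = (\<Sum>j\<in>UNIV. \<Sum>i\<in>UNIV. U $ i $ j * U $ i $ j)" by (rule sum.swap)
  finally show ?thesis by (simp add: power2_norm_eq_inner inner_vec_def column_def)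
qed

lemma op_norm_bound: "norm (U *v x) \<le> op_norm U * norm x"
  for U :: "real^'m^'n"
  unfolding op_norm_def by (intro onorm matrix_vector_mul_bounded_linear)

lemma op_norm_pos:
  fixes U :: "real^'m^'n"
  assumes "U \<noteq> 0"
  shows "0 < op_norm U"
proof -
  have "\<exists>x. U *v x \<noteq> 0"
    using assms matrix_eq[of U 0] by auto
  then show ?thesis
    unfolding op_norm_def by (simp add: onorm_pos_lt matrix_vector_mul_bounded_linear)
qed

text \<open>The left side is \<open>\<parallel>U\<^sup>t y\<parallel>\<^sup>2\<close>, and a matrix and its transpose have the same operator norm.\<close>

lemma sum_columns_inner_le:
  fixes U :: "real^'m^'n"
  shows "(\<Sum>j\<in>UNIV. (column j U \<bullet> y)\<^sup>2) \<le> (op_norm U)\<^sup>2 * (y \<bullet> y)"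
proof -
  define w where "w = transpose U *v y"
  have "w $ j = column j U \<bullet> y" for j
    by (simp add: w_def matrix_vector_mul_component transpose_def column_def)
  then have sum: "(\<Sum>j\<in>UNIV. (column j U \<bullet> y)\<^sup>2) = (norm w)\<^sup>2"
    unfolding power2_norm_eq_inner by (simp add: inner_vec_def[of w] power2_eq_square)
  have "(norm w)\<^sup>2 = y \<bullet> (U *v w)"
    unfolding power2_norm_eq_inner
    by (subst (1) w_def) (simp add: dot_lmul_matrix transpose_matrix_vector)
  also have "\<dots> \<le> norm y * norm (U *v w)" by (rule norm_cauchy_schwarz)
  also have "\<dots> \<le> norm y * (op_norm U * norm w)" by (intro mult_left_mono op_norm_bound) auto
  finally have "norm w * norm w \<le> (op_norm U * norm y) * norm w"
    by (simp add: power2_eq_square mult_ac)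
  moreover have "0 \<le> op_norm U" unfolding op_norm_def by (intro onorm_pos_le matrix_vector_mul_bounded_linear)
  ultimately have "norm w \<le> op_norm U * norm y"
    by (cases "w = 0") auto
  then have "(norm w)\<^sup>2 \<le> (op_norm U * norm y)\<^sup>2" by (intro power_mono) auto
  then show ?thesis by (simp add: sum power_mult_distrib power2_norm_eq_inner)
qed

lemma normalize_columns_mult_unit:
  fixes U :: "real^'m^'n"
  assumes "x \<in> unit_vectors_on \<sigma>"
  shows "normalize_columns U *v x = (\<Sum>j\<in>\<sigma>. x $ j *\<^sub>R (column j U /\<^sub>R norm (column j U)))"
    and "(\<Sum>j\<in>\<sigma>. (x $ j)\<^sup>2) = 1"
proof -
  have x: "norm x = 1" "\<And>j. j \<notin> \<sigma> \<Longrightarrow> x $ j = 0" using assms by (auto simp: unit_vectors_on_def)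
  have "normalize_columns U *v x = (\<Sum>j\<in>UNIV. x $ j *\<^sub>R (column j U /\<^sub>R norm (column j U)))"
    by (simp add: matrix_mult_sum column_normalize_columns scalar_mult_eq_scaleR)
  also have "\<dots> = (\<Sum>j\<in>\<sigma>. x $ j *\<^sub>R (column j U /\<^sub>R norm (column j U)))"
    using x(2) by (intro sum.mono_neutral_right) auto
  finally show "normalize_columns U *v x = (\<Sum>j\<in>\<sigma>. x $ j *\<^sub>R (column j U /\<^sub>R norm (column j U)))" .
  have "(\<Sum>j\<in>\<sigma>. (x $ j)\<^sup>2) = (\<Sum>j\<in>UNIV. (x $ j)\<^sup>2)"
    using x(2) by (intro sum.mono_neutral_left) auto
  also have "\<dots> = (norm x)\<^sup>2" unfolding power2_norm_eq_inner by (simp add: inner_vec_def power2_eq_square)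
  finally show "(\<Sum>j\<in>\<sigma>. (x $ j)\<^sup>2) = 1" using x(1) by simp
qed

theorem theorem1p1:
  fixes U :: "real^'m^'n" and \<epsilon> :: real
  assumes "U \<noteq> 0" and "0 < \<epsilon>" and "\<epsilon> < 1"
  shows "\<exists>\<sigma> :: 'm set.
    (\<forall>j\<in>\<sigma>. column j U \<noteq> 0) \<and>
    real (card \<sigma>) \<ge> (1 - \<epsilon>)\<^sup>2 * ((hs_norm U)\<^sup>2 / (op_norm U)\<^sup>2) \<and>
    \<epsilon> / (2 - \<epsilon>) \<le> s_min (normalize_columns U) \<sigma> \<and>
    s_min (normalize_columns U) \<sigma> \<le> s_max (normalize_columns U) \<sigma> \<and>
    s_max (normalize_columns U) \<sigma> \<le> (2 - \<epsilon>) / \<epsilon> \<and>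
    (\<forall>a :: 'm \<Rightarrow> real.
      \<epsilon> / (2 - \<epsilon>) * sqrt (\<Sum>j\<in>\<sigma>. (a j)\<^sup>2)
        \<le> norm (\<Sum>j\<in>\<sigma>. a j *\<^sub>R (column j U /\<^sub>R norm (column j U))) \<and>
      norm (\<Sum>j\<in>\<sigma>. a j *\<^sub>R (column j U /\<^sub>R norm (column j U)))
        \<le> (2 - \<epsilon>) / \<epsilon> * sqrt (\<Sum>j\<in>\<sigma>. (a j)\<^sup>2))"
proof -
  define N where "N = op_norm U"
  have N: "0 < N" unfolding N_def using assms(1) by (rule op_norm_pos)
  define v where "v j = (1 / N) *\<^sub>R column j U" for j
  have bessel: "(\<Sum>j\<in>UNIV. (v j \<bullet> x)\<^sup>2) \<le> x \<bullet> x" for x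
  proof -
    have "(\<Sum>j\<in>UNIV. (v j \<bullet> x)\<^sup>2) = (\<Sum>j\<in>UNIV. (column j U \<bullet> x)\<^sup>2) / N\<^sup>2"
      by (simp add: v_def power_divide sum_divide_distrib)
    also have "\<dots> \<le> x \<bullet> x"
      using sum_columns_inner_le[of U x] N by (simp add: N_def field_simps)
    finally show ?thesis .
  qed
  have mass: "(\<Sum>j\<in>UNIV. (norm (v j))\<^sup>2) = (hs_norm U)\<^sup>2 / (op_norm U)\<^sup>2"
    by (simp add: v_def hs_norm_columns power_divide sum_divide_distrib N_def[symmetric])
  have "\<exists>j. column j U \<noteq> 0"
    using assms(1) by (auto simp: vec_eq_iff column_def)
  then have "0 < (hs_norm U)\<^sup>2"
    unfolding hs_norm_columns by (auto intro: sum_pos2)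
  then have mass0: "0 < (\<Sum>j\<in>UNIV. (norm (v j))\<^sup>2)" unfolding mass using N by (simp add: N_def)
  obtain \<sigma> c where \<sigma>: "(1 - \<epsilon>)\<^sup>2 * ((hs_norm U)\<^sup>2 / (op_norm U)\<^sup>2) \<le> card \<sigma>"
      and bar: "between_barriers v c \<sigma> (\<epsilon>\<^sup>2) ((2 - \<epsilon>)\<^sup>2)"
    using barrier_selection[OF finite_class.finite_UNIV bessel assms(2,3) mass0] unfolding mass by auto
  have e2: "0 < \<epsilon>\<^sup>2" "0 < (2 - \<epsilon>)\<^sup>2" using assms by auto
  note unweighted = unweight[OF bar finite_class.finite e2]
  have sgn_v: "sgn (v j) = column j U /\<^sub>R norm (column j U)" for j
  proof -
    have "sgn (1 / N) = 1" using N by simp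
    then have "sgn (v j) = sgn (column j U)" unfolding v_def sgn_scaleR by simp
    then show ?thesis by (simp add: sgn_div_norm)
  qed
  have bounds: "\<epsilon> / (2 - \<epsilon>) * sqrt (\<Sum>j\<in>\<sigma>. (a j)\<^sup>2)
        \<le> norm (\<Sum>j\<in>\<sigma>. a j *\<^sub>R (column j U /\<^sub>R norm (column j U)))"
      "norm (\<Sum>j\<in>\<sigma>. a j *\<^sub>R (column j U /\<^sub>R norm (column j U)))
        \<le> (2 - \<epsilon>) / \<epsilon> * sqrt (\<Sum>j\<in>\<sigma>. (a j)\<^sup>2)" for a
  proof -
    have S: "0 \<le> (\<Sum>j\<in>\<sigma>. (a j)\<^sup>2)" by (intro sum_nonneg) auto
    have lo: "(\<epsilon> / (2 - \<epsilon>) * sqrt (\<Sum>j\<in>\<sigma>. (a j)\<^sup>2))\<^sup>2 = \<epsilon>\<^sup>2 / (2 - \<epsilon>)\<^sup>2 * (\<Sum>j\<in>\<sigma>. (a j)\<^sup>2)"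
      using S by (simp add: power_mult_distrib power_divide)
    show "\<epsilon> / (2 - \<epsilon>) * sqrt (\<Sum>j\<in>\<sigma>. (a j)\<^sup>2)
        \<le> norm (\<Sum>j\<in>\<sigma>. a j *\<^sub>R (column j U /\<^sub>R norm (column j U)))"
      using unweighted(2)[of a] unfolding sgn_v lo[symmetric]
      by (rule power2_le_imp_le) (rule norm_ge_zero)
    have up: "((2 - \<epsilon>) / \<epsilon> * sqrt (\<Sum>j\<in>\<sigma>. (a j)\<^sup>2))\<^sup>2 = (2 - \<epsilon>)\<^sup>2 / \<epsilon>\<^sup>2 * (\<Sum>j\<in>\<sigma>. (a j)\<^sup>2)"
      using S by (simp add: power_mult_distrib power_divide)
    show "norm (\<Sum>j\<in>\<sigma>. a j *\<^sub>R (column j U /\<^sub>R norm (column j U)))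
        \<le> (2 - \<epsilon>) / \<epsilon> * sqrt (\<Sum>j\<in>\<sigma>. (a j)\<^sup>2)"
      using unweighted(3)[of a] unfolding sgn_v up[symmetric]
      by (rule power2_le_imp_le) (use assms S in simp)
  qed
  have nonzero: "column j U \<noteq> 0" if "j \<in> \<sigma>" for j
    using unweighted(1)[OF that] by (auto simp: v_def)
  have "0 < (1 - \<epsilon>)\<^sup>2 * ((hs_norm U)\<^sup>2 / (op_norm U)\<^sup>2)"
    using mass0 assms(3) unfolding mass by (intro mult_pos_pos) auto
  with \<sigma> have "\<sigma> \<noteq> {}" by auto
  obtain x where x: "x \<in> unit_vectors_on \<sigma>" "s_min (normalize_columns U) \<sigma> = norm (normalize_columns U *v x)"
      "\<forall>y\<in>unit_vectors_on \<sigma>. norm (normalize_columns U *v x) \<le> norm (normalize_columns U *v y)"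
    using s_min_attained[OF \<open>\<sigma> \<noteq> {}\<close>] by blast
  obtain y where y: "y \<in> unit_vectors_on \<sigma>" "s_max (normalize_columns U) \<sigma> = norm (normalize_columns U *v y)"
    using s_max_attained[OF \<open>\<sigma> \<noteq> {}\<close>] by blast
  have "\<epsilon> / (2 - \<epsilon>) \<le> s_min (normalize_columns U) \<sigma>"
    using bounds(1)[of "\<lambda>j. x $ j"] unfolding x(2) normalize_columns_mult_unit[OF x(1)] by simp
  moreover have "s_min (normalize_columns U) \<sigma> \<le> s_max (normalize_columns U) \<sigma>"
    using x y by simp
  moreover have "s_max (normalize_columns U) \<sigma> \<le> (2 - \<epsilon>) / \<epsilon>"
    using bounds(2)[of "\<lambda>j. y $ j"] unfolding y(2) normalize_columns_mult_unit[OF y(1)] by simp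
  ultimately show ?thesis using \<sigma> nonzero bounds by blast
qed

end
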